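(* Let $p$ and $q$ be distinct primes with $pq\neq 6$ and $q\mid p+1$. Let $D\in GF(p)$ be a non-square, let $\sigma$ be a primitive root (generator of the multiplicative group) of $GF(p^{2})=GF(p)(\sqrt{D})$, and let $m,n\in GF(p)$ be given by $m+n\sqrt{D}=\sigma^{\frac{p^{2}-1}{q}}$; assume $n\neq 0$. Let $G=\langle a,b,c\mid a^{q^{2}}=b^{p}=c^{p}=[b,c]=1,\ a^{-1}ba=b^{m}c^{nD},\ a^{-1}ca=b^{n}c^{m}\rangle$. Then $\mathrm{Aut}(G)\simeq(\mathbb{Z}_{p}\times\mathbb{Z}_{p})\rtimes((\mathbb{Z}_{p^{2}-1}\times\mathbb{Z}_{q})\rtimes\mathbb{Z}_{2})$.
   Context: $\mathbb{Z}_n$ is the cyclic group of order $n$; $GF(p^k)$ is the field with $p^k$ elements; $[x,y]=x^{-1}y^{-1}xy$. Exponents of $b,c$ lying in $GF(p)$ are interpreted via integer representatives. $X\rtimes Y$ denotes a semidirect product with normal subgroup $X$ with respect to some homomorphism $Y\to\mathrm{Aut}(X)$; the statement asserts that $\mathrm{Aut}(G)$ is isomorphic to such an (iterated) semidirect product for some choice of actions. *)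

theory Defs
  imports "HOL-Number_Theory.Residues" "HOL-Algebra.Bij"
begin

section \<open>Groups given by generators and relations\<close>

text \<open>A word over the generators \<open>'g\<close> is a list of letters; \<open>(x, True)\<close> stands for \<open>x\<close> and
  \<open>(x, False)\<close> for its formal inverse. A relation \<open>l = r\<close> is a pair of words. The generators of the
  presented group are all elements of the type \<open>'g\<close>.\<close>

type_synonym 'g word = "('g \<times> bool) list"

inductive pres_eq :: "('g word \<times> 'g word) set \<Rightarrow> 'g word \<Rightarrow> 'g word \<Rightarrow> bool"
  for R :: "('g word \<times> 'g word) set"
  where
    refl: "pres_eq R w w"
  | sym: "pres_eq R v w \<Longrightarrow> pres_eq R w v"
  | trans: "pres_eq R u v \<Longrightarrow> pres_eq R v w \<Longrightarrow> pres_eq R u w"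
  | cancel: "pres_eq R (u @ [(x, e), (x, \<not> e)] @ v) (u @ v)"
  | rel: "(l, r) \<in> R \<Longrightarrow> pres_eq R (u @ l @ v) (u @ r @ v)"

definition pres_rel :: "('g word \<times> 'g word) set \<Rightarrow> ('g word \<times> 'g word) set"
  where "pres_rel R = {(v, w). pres_eq R v w}"

definition presented_group :: "('g word \<times> 'g word) set \<Rightarrow> 'g word set monoid"
  where "presented_group R =
    \<lparr>carrier = UNIV // pres_rel R,
     monoid.mult = (\<lambda>X Y. \<Union>v\<in>X. \<Union>w\<in>Y. pres_rel R `` {v @ w}),
     one = pres_rel R `` {[]}\<rparr>"

definition gen_pow :: "'g \<Rightarrow> int \<Rightarrow> 'g word"
  where "gen_pow x k = replicate (nat \<bar>k\<bar>) (x, 0 \<le> k)"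

definition inv_word :: "'g word \<Rightarrow> 'g word"
  where "inv_word w = rev (map (\<lambda>(x, e). (x, \<not> e)) w)"

definition comm_word :: "'g word \<Rightarrow> 'g word \<Rightarrow> 'g word"
  where "comm_word v w = inv_word v @ inv_word w @ v @ w"

lemma equiv_pres_rel: "equiv UNIV (pres_rel R)"
  by (rule equivI)
    (auto simp: pres_rel_def intro!: refl_onI symI transI intro: pres_eq.refl pres_eq.sym pres_eq.trans)

lemma pres_eq_append_left: "pres_eq R v w \<Longrightarrow> pres_eq R (u @ v) (u @ w)"
proof (induction rule: pres_eq.induct)
  case (cancel u' x e v)
  then show ?case using pres_eq.cancel[of R "u @ u'" x e v] by simp
next
  case (rel l r u' v)
  then show ?case using pres_eq.rel[of l r R "u @ u'" v] by simp
qed (auto intro: pres_eq.refl pres_eq.sym pres_eq.trans)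

lemma pres_eq_append_right: "pres_eq R v w \<Longrightarrow> pres_eq R (v @ u) (w @ u)"
proof (induction rule: pres_eq.induct)
  case (cancel u' x e v)
  then show ?case using pres_eq.cancel[of R u' x e "v @ u"] by simp
next
  case (rel l r u' v)
  then show ?case using pres_eq.rel[of l r R u' "v @ u"] by simp
qed (auto intro: pres_eq.refl pres_eq.sym pres_eq.trans)

lemma pres_eq_append: "pres_eq R v v' \<Longrightarrow> pres_eq R w w' \<Longrightarrow> pres_eq R (v @ w) (v' @ w')"
  by (blast intro: pres_eq_append_left pres_eq_append_right pres_eq.trans)

lemma pres_class_eq_iff: "pres_rel R `` {v} = pres_rel R `` {w} \<longleftrightarrow> pres_eq R v w"
  using eq_equiv_class_iff[OF equiv_pres_rel, of v w R] by (simp add: pres_rel_def)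

lemma presented_group_mult:
  "pres_rel R `` {v} \<otimes>\<^bsub>presented_group R\<^esub> pres_rel R `` {w} = pres_rel R `` {v @ w}"
proof -
  have "pres_rel R `` {v' @ w'} = pres_rel R `` {v @ w}"
    if "v' \<in> pres_rel R `` {v}" "w' \<in> pres_rel R `` {w}" for v' w'
    using that unfolding pres_class_eq_iff
    by (auto simp: pres_rel_def intro: pres_eq_append pres_eq.sym)
  moreover have "v \<in> pres_rel R `` {v}" "w \<in> pres_rel R `` {w}"
    by (auto simp: pres_rel_def intro: pres_eq.refl)
  ultimately show ?thesis
    unfolding presented_group_def monoid.simps by blast
qed

lemma pres_eq_inv_word: "pres_eq R (inv_word w @ w) []"
proof (induction w)
  case Nil
  then show ?case by (simp add: inv_word_def pres_eq.refl)
next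
  case (Cons y w)
  obtain x e where y: "y = (x, e)" by (cases y)
  have "pres_eq R (inv_word (y # w) @ y # w) (inv_word w @ w)"
    using pres_eq.cancel[of R "inv_word w" x "\<not> e" w] by (simp add: y inv_word_def)
  then show ?case using Cons.IH by (rule pres_eq.trans)
qed

lemma group_presented_group: "group (presented_group R)"
proof -
  have car: "carrier (presented_group R) = range (\<lambda>w. pres_rel R `` {w})"
    by (auto simp: presented_group_def quotient_def)
  have one: "\<one>\<^bsub>presented_group R\<^esub> = pres_rel R `` {[]}"
    by (simp add: presented_group_def)
  have inv: "\<exists>v. pres_rel R `` {v @ w} = pres_rel R `` {[]}" for w
    by (rule exI[of _ "inv_word w"]) (simp add: pres_class_eq_iff pres_eq_inv_word)
  show ?thesis
    by (rule groupI) (auto simp: car one presented_group_mult intro: inv)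
qed

section \<open>Semidirect products\<close>

text \<open>\<open>X\<close> is the normal factor. The operation is meant for \<open>\<phi> \<in> hom Y (AutoGroup X)\<close>.\<close>

definition semidirect_product ::
    "('a, 'c) monoid_scheme \<Rightarrow> ('b, 'd) monoid_scheme \<Rightarrow> ('b \<Rightarrow> 'a \<Rightarrow> 'a) \<Rightarrow> ('a \<times> 'b) monoid"
  where "semidirect_product X Y \<phi> =
    \<lparr>carrier = carrier X \<times> carrier Y,
     monoid.mult = (\<lambda>(x, y) (x', y'). (x \<otimes>\<^bsub>X\<^esub> \<phi> y x', y \<otimes>\<^bsub>Y\<^esub> y')),
     one = (\<one>\<^bsub>X\<^esub>, \<one>\<^bsub>Y\<^esub>)\<rparr>"

lemma group_semidirect_product:
  assumes "group X" "group Y" and \<phi>: "\<phi> \<in> hom Y (AutoGroup X)"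
  shows "group (semidirect_product X Y \<phi>)"
proof -
  interpret X: group X by fact
  interpret Y: group Y by fact
  interpret A: group "AutoGroup X" by (rule X.AutoGroup)
  interpret h: group_hom Y "AutoGroup X" \<phi>
    by unfold_locales (rule \<phi>)
  have auto: "\<phi> y \<in> auto X" if "y \<in> carrier Y" for y
    using h.hom_closed[OF that] by (simp add: AutoGroup_def)
  have cl: "\<phi> y x \<in> carrier X" if "y \<in> carrier Y" "x \<in> carrier X" for x y
    using auto[OF that(1)] that(2) by (auto simp: auto_def hom_def)
  have mul: "\<phi> y (x \<otimes>\<^bsub>X\<^esub> x') = \<phi> y x \<otimes>\<^bsub>X\<^esub> \<phi> y x'"
    if "y \<in> carrier Y" "x \<in> carrier X" "x' \<in> carrier X" for x x' y
    using auto[OF that(1)] that(2,3) by (auto simp: auto_def hom_def)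
  have act: "\<phi> (y \<otimes>\<^bsub>Y\<^esub> y') x = \<phi> y (\<phi> y' x)"
    if "y \<in> carrier Y" "y' \<in> carrier Y" "x \<in> carrier X" for x y y'
    using that auto[OF that(1)] auto[OF that(2)]
    by (simp add: h.hom_mult AutoGroup_def BijGroup_def auto_def compose_def)
  have act1: "\<phi> \<one>\<^bsub>Y\<^esub> x = x" if "x \<in> carrier X" for x
    using that h.hom_one by (simp add: AutoGroup_def BijGroup_def)
  show ?thesis
  proof (rule groupI, goal_cases)
    case (5 z)
    then obtain x y where z: "z = (x, y)" "x \<in> carrier X" "y \<in> carrier Y"
      by (auto simp: semidirect_product_def)
    let ?y = "inv\<^bsub>Y\<^esub> y"
    have "\<phi> ?y (inv\<^bsub>X\<^esub> x) \<otimes>\<^bsub>X\<^esub> \<phi> ?y x = \<phi> ?y \<one>\<^bsub>X\<^esub>"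
      using z mul[of ?y "inv\<^bsub>X\<^esub> x" x] by (simp del: h.hom_inv)
    also have "\<phi> ?y \<one>\<^bsub>X\<^esub> = \<one>\<^bsub>X\<^esub>"
      using mul[of ?y "\<one>\<^bsub>X\<^esub>" "\<one>\<^bsub>X\<^esub>"] cl[of ?y "\<one>\<^bsub>X\<^esub>"] z by (simp del: h.hom_inv)
    finally show ?case
      using z cl by (intro bexI[of _ "(\<phi> ?y (inv\<^bsub>X\<^esub> x), ?y)"]) (auto simp: semidirect_product_def simp del: h.hom_inv)
  qed (auto simp: semidirect_product_def cl mul act act1 X.m_assoc Y.m_assoc
      simp del: h.hom_mult h.hom_one)
qed

section \<open>The group \<open>G\<close>\<close>

datatype gen = Gen_a | Gen_b | Gen_c

text \<open>The integers \<open>D\<close>, \<open>m\<close>, \<open>n\<close> are representatives of elements of \<open>GF(p)\<close>.\<close>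

definition G_relations :: "nat \<Rightarrow> nat \<Rightarrow> int \<Rightarrow> int \<Rightarrow> int \<Rightarrow> (gen word \<times> gen word) set"
  where "G_relations p q D m n =
    {(gen_pow Gen_a (int (q^2)), []),
     (gen_pow Gen_b (int p), []),
     (gen_pow Gen_c (int p), []),
     (comm_word (gen_pow Gen_b 1) (gen_pow Gen_c 1), []),
     (gen_pow Gen_a (- 1) @ gen_pow Gen_b 1 @ gen_pow Gen_a 1, gen_pow Gen_b m @ gen_pow Gen_c (n * D)),
     (gen_pow Gen_a (- 1) @ gen_pow Gen_c 1 @ gen_pow Gen_a 1, gen_pow Gen_b n @ gen_pow Gen_c m)}"

definition G_group :: "nat \<Rightarrow> nat \<Rightarrow> int \<Rightarrow> int \<Rightarrow> int \<Rightarrow> gen word set monoid"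
  where "G_group p q D m n = presented_group (G_relations p q D m n)"

end

theory Submission
  imports Defs "HOL-Decision_Procs.Algebra_Aux"
begin

text \<open>Put \<open>w = \<sigma> ^ ((p^2 - 1) / q)\<close>, an element of order \<open>q\<close> outside the prime field. The map
  \<open>b \<mapsto> s\<close>, \<open>c \<mapsto> 1\<close> identifies the subgroup generated by \<open>b\<close> and \<open>c\<close> with the additive group of \<open>K\<close>,
  and the two conjugation relations then say that conjugation by \<open>a\<close> is multiplication by \<open>w\<close>. So \<open>G\<close> is
  the semidirect product \<open>H\<close> of \<open>K\<close> with the cyclic group of order \<open>q^2\<close> acting through powers of
  \<open>w\<close>: the relations bring every word into the form \<open>b^i c^j a^k\<close> (\<open>word_eval_normal_form\<close>), and in \<open>H\<close>
  such a word is trivial only if \<open>p\<close> divides \<open>i\<close> and \<open>j\<close> and \<open>q^2\<close> divides \<open>k\<close> (\<open>G_group_iso_H\<close>).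

  The subgroup \<open>K\<close> of \<open>H\<close> is characteristic, since \<open>p\<close> and \<open>q\<close> are coprime. An automorphism restricts to
  an additive map \<open>f\<close> of \<open>K\<close> and sends the generator of the cyclic factor into a coset of \<open>K\<close>, say with
  exponent \<open>i\<close>; compatibility with the action means \<open>f (w x) = w^i f x\<close>. As \<open>1\<close> and \<open>w\<close> span \<open>K\<close> over
  the prime field, \<open>w^i\<close> must be a conjugate of \<open>w\<close>, and \<open>f\<close> is multiplication by \<open>u = f 1\<close>, possibly
  preceded by the nontrivial field automorphism (\<open>semilinear_cases\<close>). Because \<open>q\<close> divides \<open>p + 1\<close>, the norm of
  \<open>w\<close> is \<open>1\<close> (\<open>norm_w\<close>), so the conjugate of \<open>w\<close> is its inverse and \<open>i\<close> is congruent to \<open>1\<close> or \<open>-1\<close>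
  modulo \<open>q\<close> accordingly. After composition with conjugation by an element of \<open>K\<close> the generator goes to its
  \<open>i\<close>-th power, since \<open>1 - w^i\<close> is invertible.

  Every automorphism is thus described by \<open>(v, u, \<epsilon>, i)\<close>: a translation part \<open>v\<close> in \<open>K\<close>, a unit \<open>u\<close>, a choice
  \<open>\<epsilon>\<close> of field automorphism and a residue \<open>i\<close> modulo \<open>q^2\<close> that is \<open>\<plusminus>1\<close> modulo \<open>q\<close>
  (\<open>auto_H_exhaust\<close>, \<open>aff_eqD\<close>), with the composition law \<open>aff_comp\<close>. The translations give
  \<open>Z_p \<times> Z_p\<close>, the units give \<open>Z_(p^2 - 1)\<close>, the residues \<open>1 + q l\<close> give \<open>Z_q\<close>, and the field
  automorphism together with \<open>i = -1\<close> gives an involution normalising the last two. The recognition criterion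
  \<open>semidirect_product_hom_exists\<close>, applied twice, turns this into the iterated semidirect product.\<close>

section \<open>Recognising semidirect products\<close>

text \<open>An internal criterion: if the image of \<open>g\<close> normalises that of \<open>f\<close>, then conjugation defines the
  action, and the product map is a homomorphism for it. The result is a map into \<open>G\<close>,
  so that a second application can take it in the place of \<open>g\<close> and build an iterated product.\<close>

lemma (in group) semidirect_product_hom_exists:
  fixes X :: "('x, 'e) monoid_scheme" and Y :: "('y, 'f) monoid_scheme"
  assumes X: "group X" and Y: "group Y"
    and f: "f \<in> hom X G" and g: "g \<in> hom Y G"
    and inj: "inj_on (\<lambda>(x, y). f x \<otimes> g y) (carrier X \<times> carrier Y)"
    and norm: "\<And>x y. x \<in> carrier X \<Longrightarrow> y \<in> carrier Y \<Longrightarrow>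
                 \<exists>x'\<in>carrier X. g y \<otimes> f x = f x' \<otimes> g y"
  obtains \<phi> where "\<phi> \<in> hom Y (AutoGroup X)"
    and "(\<lambda>(x, y). f x \<otimes> g y) \<in> hom (semidirect_product X Y \<phi>) G"
proof -
  interpret X: group X by fact
  interpret Y: group Y by fact
  interpret f: group_hom X G f by unfold_locales (rule f)
  interpret g: group_hom Y G g by unfold_locales (rule g)
  have finj: "x = x'" if "x \<in> carrier X" "x' \<in> carrier X" "f x = f x'" for x x'
    using inj_onD[OF inj, of "(x, \<one>\<^bsub>Y\<^esub>)" "(x', \<one>\<^bsub>Y\<^esub>)"] that by simp
  define \<phi> where "\<phi> = (\<lambda>y. \<lambda>x\<in>carrier X. THE x'. x' \<in> carrier X \<and> g y \<otimes> f x = f x' \<otimes> g y)"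
  have uniq: "\<phi> y x = x'"
    if "x \<in> carrier X" "y \<in> carrier Y" "x' \<in> carrier X" "g y \<otimes> f x = f x' \<otimes> g y" for x x' y
    unfolding \<phi>_def using that by (auto intro!: the_equality finj)
  have cl: "\<phi> y x \<in> carrier X" and spec: "g y \<otimes> f x = f (\<phi> y x) \<otimes> g y"
    if "x \<in> carrier X" "y \<in> carrier Y" for x y
    using norm[OF that] uniq that by metis+
  have mul: "\<phi> y (x \<otimes>\<^bsub>X\<^esub> x') = \<phi> y x \<otimes>\<^bsub>X\<^esub> \<phi> y x'"
    if "y \<in> carrier Y" "x \<in> carrier X" "x' \<in> carrier X" for x x' y
  proof (rule uniq)
    have "g y \<otimes> f (x \<otimes>\<^bsub>X\<^esub> x') = (g y \<otimes> f x) \<otimes> f x'"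
      using that by (simp add: m_assoc)
    also have "\<dots> = f (\<phi> y x) \<otimes> (g y \<otimes> f x')"
      using that cl by (simp add: spec m_assoc)
    also have "\<dots> = f (\<phi> y x \<otimes>\<^bsub>X\<^esub> \<phi> y x') \<otimes> g y"
      using that cl by (simp add: spec m_assoc)
    finally show "g y \<otimes> f (x \<otimes>\<^bsub>X\<^esub> x') = f (\<phi> y x \<otimes>\<^bsub>X\<^esub> \<phi> y x') \<otimes> g y" .
  qed (use that cl in auto)
  have act: "\<phi> (y \<otimes>\<^bsub>Y\<^esub> y') x = \<phi> y (\<phi> y' x)"
    if "y \<in> carrier Y" "y' \<in> carrier Y" "x \<in> carrier X" for x y y'
  proof (rule uniq)
    have "g (y \<otimes>\<^bsub>Y\<^esub> y') \<otimes> f x = g y \<otimes> (g y' \<otimes> f x)"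
      using that by (simp add: m_assoc)
    also have "\<dots> = g y \<otimes> (f (\<phi> y' x) \<otimes> g y')"
      using that by (simp add: spec)
    also have "\<dots> = (g y \<otimes> f (\<phi> y' x)) \<otimes> g y'"
      using that cl by (simp add: m_assoc)
    also have "\<dots> = f (\<phi> y (\<phi> y' x)) \<otimes> g (y \<otimes>\<^bsub>Y\<^esub> y')"
      using that cl by (simp add: spec m_assoc)
    finally show "g (y \<otimes>\<^bsub>Y\<^esub> y') \<otimes> f x = f (\<phi> y (\<phi> y' x)) \<otimes> g (y \<otimes>\<^bsub>Y\<^esub> y')" .
  qed (use that cl in auto)
  have act1: "\<phi> \<one>\<^bsub>Y\<^esub> x = x" if "x \<in> carrier X" for x
    using that by (intro uniq) auto
  have bij: "\<phi> y \<in> Bij (carrier X)" if y: "y \<in> carrier Y" for y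
  proof -
    have "bij_betw (\<phi> y) (carrier X) (carrier X)"
    proof (rule bij_betw_byWitness[where f' = "\<phi> (inv\<^bsub>Y\<^esub> y)"])
      show "\<forall>x\<in>carrier X. \<phi> (inv\<^bsub>Y\<^esub> y) (\<phi> y x) = x"
        using y act[of "inv\<^bsub>Y\<^esub> y" y] by (simp add: act1)
      show "\<forall>x\<in>carrier X. \<phi> y (\<phi> (inv\<^bsub>Y\<^esub> y) x) = x"
        using y act[of y "inv\<^bsub>Y\<^esub> y"] by (simp add: act1)
    qed (use y cl in auto)
    then show ?thesis by (simp add: Bij_def \<phi>_def)
  qed
  have auto: "\<phi> y \<in> auto X" if "y \<in> carrier Y" for y
    using that bij cl mul by (auto simp: auto_def hom_def)
  have "\<phi> \<in> hom Y (AutoGroup X)"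
  proof (rule homI)
    fix y y' assume y: "y \<in> carrier Y" "y' \<in> carrier Y"
    show "\<phi> (y \<otimes>\<^bsub>Y\<^esub> y') = \<phi> y \<otimes>\<^bsub>AutoGroup X\<^esub> \<phi> y'"
    proof (rule extensionalityI[where A = "carrier X"])
      show "\<phi> (y \<otimes>\<^bsub>Y\<^esub> y') \<in> extensional (carrier X)" by (simp add: \<phi>_def)
      show "\<phi> y \<otimes>\<^bsub>AutoGroup X\<^esub> \<phi> y' \<in> extensional (carrier X)"
        using y by (simp add: AutoGroup_def BijGroup_def bij)
      show "\<phi> (y \<otimes>\<^bsub>Y\<^esub> y') x = (\<phi> y \<otimes>\<^bsub>AutoGroup X\<^esub> \<phi> y') x" if "x \<in> carrier X" for x
        using y that by (simp add: AutoGroup_def BijGroup_def bij act compose_def)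
    qed
  qed (simp add: AutoGroup_def auto)
  moreover have "(\<lambda>(x, y). f x \<otimes> g y) \<in> hom (semidirect_product X Y \<phi>) G"
  proof (rule homI)
    fix z z' assume "z \<in> carrier (semidirect_product X Y \<phi>)" "z' \<in> carrier (semidirect_product X Y \<phi>)"
    then obtain x y x' y' where z: "z = (x, y)" "z' = (x', y')"
      "x \<in> carrier X" "y \<in> carrier Y" "x' \<in> carrier X" "y' \<in> carrier Y"
      by (auto simp: semidirect_product_def)
    have "f (x \<otimes>\<^bsub>X\<^esub> \<phi> y x') \<otimes> g (y \<otimes>\<^bsub>Y\<^esub> y') = f x \<otimes> ((f (\<phi> y x') \<otimes> g y) \<otimes> g y')"
      using z cl by (simp add: m_assoc)
    also have "\<dots> = f x \<otimes> ((g y \<otimes> f x') \<otimes> g y')"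
      using z cl by (simp add: spec)
    also have "\<dots> = (f x \<otimes> g y) \<otimes> (f x' \<otimes> g y')"
      using z by (simp add: m_assoc)
    finally show "(case z \<otimes>\<^bsub>semidirect_product X Y \<phi>\<^esub> z' of (x, y) \<Rightarrow> f x \<otimes> g y) =
        (case z of (x, y) \<Rightarrow> f x \<otimes> g y) \<otimes> (case z' of (x, y) \<Rightarrow> f x \<otimes> g y)"
      by (simp add: z semidirect_product_def)
  qed (auto simp: semidirect_product_def)
  ultimately show thesis by (rule that)
qed

section \<open>Automorphism groups of isomorphic groups\<close>

lemma AutoGroup_mult_apply:
  assumes "\<alpha> \<in> auto G" "\<beta> \<in> auto G" "x \<in> carrier G"
  shows "(\<alpha> \<otimes>\<^bsub>AutoGroup G\<^esub> \<beta>) x = \<alpha> (\<beta> x)"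
  using assms by (simp add: AutoGroup_def BijGroup_def auto_def compose_def)

lemma auto_eqI:
  assumes "\<alpha> \<in> auto G" "\<beta> \<in> auto G" "\<And>x. x \<in> carrier G \<Longrightarrow> \<alpha> x = \<beta> x"
  shows "\<alpha> = \<beta>"
  using assms by (auto simp: auto_def Bij_def intro: extensionalityI)

lemma carrier_AutoGroup: "carrier (AutoGroup G) = auto G"
  by (simp add: AutoGroup_def)

lemma auto_transport:
  fixes G :: "('c, 'd) monoid_scheme" and H :: "('e, 'f) monoid_scheme"
  assumes "group G" "group H" and h: "h \<in> hom G H" and k: "k \<in> hom H G"
    and hk: "\<And>y. y \<in> carrier H \<Longrightarrow> h (k y) = y" and kh: "\<And>x. x \<in> carrier G \<Longrightarrow> k (h x) = x"
    and \<alpha>: "\<alpha> \<in> auto G"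
  shows "(\<lambda>y\<in>carrier H. h (\<alpha> (k y))) \<in> auto H"
proof -
  interpret G: group G by fact
  interpret H: group H by fact
  have \<alpha>h: "\<alpha> \<in> hom G G" and \<alpha>b: "bij_betw \<alpha> (carrier G) (carrier G)"
    using \<alpha> by (auto simp: auto_def Bij_def)
  have hom: "(\<lambda>y. h (\<alpha> (k y))) \<in> hom H H"
    using h k \<alpha>h by (auto simp: hom_def Pi_def)
  have "bij_betw h (carrier G) (carrier H)" "bij_betw k (carrier H) (carrier G)"
    using h k hk kh by (auto intro!: bij_betw_byWitness[where f' = k] bij_betw_byWitness[where f' = h] simp: hom_def)
  then have "bij_betw (h \<circ> \<alpha> \<circ> k) (carrier H) (carrier H)"
    using \<alpha>b by (blast intro: bij_betw_trans)
  then have "bij_betw (\<lambda>y\<in>carrier H. h (\<alpha> (k y))) (carrier H) (carrier H)"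
    by (subst bij_betw_cong[where g = "h \<circ> \<alpha> \<circ> k"]) auto
  then show ?thesis
    using hom by (simp add: auto_def Bij_def hom_def Pi_def)
qed

lemma AutoGroup_iso:
  assumes G: "group G" and H: "group H" and "G \<cong> H"
  shows "AutoGroup G \<cong> AutoGroup H"
proof -
  interpret G: group G by fact
  interpret H: group H by fact
  interpret AG: group "AutoGroup G" by (rule G.AutoGroup)
  interpret AH: group "AutoGroup H" by (rule H.AutoGroup)
  from \<open>G \<cong> H\<close> obtain h where h: "h \<in> iso G H" by (auto simp: is_iso_def)
  define k where "k = inv_into (carrier G) h"
  have k: "k \<in> iso H G" using h unfolding k_def by (rule G.iso_set_sym)
  have b: "bij_betw h (carrier G) (carrier H)" using h by (simp add: iso_def)
  have hh: "h \<in> hom G H" and kk: "k \<in> hom H G" using h k by (auto simp: iso_def)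
  have hk: "h (k y) = y" if "y \<in> carrier H" for y
    using b that unfolding k_def by (rule bij_betw_inv_into_right)
  have kh: "k (h x) = x" if "x \<in> carrier G" for x
    using b that unfolding k_def by (rule bij_betw_inv_into_left)
  have hc: "h x \<in> carrier H" if "x \<in> carrier G" for x
    using hh that by (auto simp: hom_def)
  have kc: "k x \<in> carrier G" if "x \<in> carrier H" for x
    using kk that by (auto simp: hom_def)
  define F where "F = (\<lambda>\<alpha>. \<lambda>y\<in>carrier H. h (\<alpha> (k y)))"
  define F' where "F' = (\<lambda>\<beta>. \<lambda>x\<in>carrier G. k (\<beta> (h x)))"
  have F: "F \<alpha> \<in> auto H" if "\<alpha> \<in> auto G" for \<alpha>
    unfolding F_def by (rule auto_transport[OF G H hh kk]) (use hk kh that in auto)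
  have F': "F' \<beta> \<in> auto G" if "\<beta> \<in> auto H" for \<beta>
    unfolding F'_def by (rule auto_transport[OF H G kk hh]) (use hk kh that in auto)
  have ac: "\<alpha> x \<in> carrier G" if "\<alpha> \<in> auto G" "x \<in> carrier G" for \<alpha> x
    using that by (auto simp: auto_def hom_def)
  have bc: "\<alpha> x \<in> carrier H" if "\<alpha> \<in> auto H" "x \<in> carrier H" for \<alpha> x
    using that by (auto simp: auto_def hom_def)
  have "F \<in> hom (AutoGroup G) (AutoGroup H)"
  proof (rule homI)
    fix \<alpha> \<beta> assume "\<alpha> \<in> carrier (AutoGroup G)" "\<beta> \<in> carrier (AutoGroup G)"
    then have *: "\<alpha> \<in> auto G" "\<beta> \<in> auto G" by (auto simp: carrier_AutoGroup)
    have m: "\<alpha> \<otimes>\<^bsub>AutoGroup G\<^esub> \<beta> \<in> auto G" "F \<alpha> \<otimes>\<^bsub>AutoGroup H\<^esub> F \<beta> \<in> auto H"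
      using * F AG.m_closed AH.m_closed by (simp_all add: carrier_AutoGroup)
    show "F (\<alpha> \<otimes>\<^bsub>AutoGroup G\<^esub> \<beta>) = F \<alpha> \<otimes>\<^bsub>AutoGroup H\<^esub> F \<beta>"
      by (rule auto_eqI[of _ H])
        (use * m F in \<open>auto simp: AutoGroup_mult_apply F_def kh hc kc ac\<close>)
  qed (use F in \<open>simp add: carrier_AutoGroup\<close>)
  moreover have "bij_betw F (carrier (AutoGroup G)) (carrier (AutoGroup H))"
  proof (rule bij_betw_byWitness[where f' = F'])
    show "\<forall>\<alpha>\<in>carrier (AutoGroup G). F' (F \<alpha>) = \<alpha>"
      by (auto simp: carrier_AutoGroup intro!: auto_eqI[of _ G] F F')
        (simp add: F_def F'_def kh hc kc ac)
    show "\<forall>\<beta>\<in>carrier (AutoGroup H). F (F' \<beta>) = \<beta>"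
      by (auto simp: carrier_AutoGroup intro!: auto_eqI[of _ H] F F')
        (simp add: F_def F'_def hk hc kc bc)
  qed (use F F' in \<open>auto simp: carrier_AutoGroup\<close>)
  ultimately show ?thesis by (auto simp: is_iso_def iso_def)
qed

section \<open>Groups given by generators and relations\<close>

primrec word_eval :: "('a, 'b) monoid_scheme \<Rightarrow> ('g \<Rightarrow> 'a) \<Rightarrow> 'g word \<Rightarrow> 'a"
  where
    "word_eval H \<gamma> [] = \<one>\<^bsub>H\<^esub>"
  | "word_eval H \<gamma> (l # w) =
       (if snd l then \<gamma> (fst l) else inv\<^bsub>H\<^esub> (\<gamma> (fst l))) \<otimes>\<^bsub>H\<^esub> word_eval H \<gamma> w"

context group
begin

context
  fixes \<gamma> :: "'g \<Rightarrow> 'a"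
  assumes gens: "\<And>x. \<gamma> x \<in> carrier G"
begin

lemma word_eval_closed [simp]: "word_eval G \<gamma> w \<in> carrier G"
  by (induction w) (auto simp: gens)

lemma word_eval_append: "word_eval G \<gamma> (v @ w) = word_eval G \<gamma> v \<otimes> word_eval G \<gamma> w"
  by (induction v) (auto simp: gens m_assoc)

lemma word_eval_inv_word: "word_eval G \<gamma> (inv_word w) = inv (word_eval G \<gamma> w)"
proof (induction w)
  case (Cons l w)
  have "inv_word (l # w) = inv_word w @ [(fst l, \<not> snd l)]"
    by (simp add: inv_word_def case_prod_beta)
  then show ?case
    using Cons by (auto simp: word_eval_append gens inv_mult_group)
qed (simp add: inv_word_def)

lemma word_eval_gen_pow: "word_eval G \<gamma> (gen_pow x k) = \<gamma> x [^] k"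
proof -
  have rep: "word_eval G \<gamma> (replicate n (x, e)) = (if e then \<gamma> x else inv (\<gamma> x)) [^] n" for n e
  proof (induction n)
    case (Suc n)
    let ?g = "if e then \<gamma> x else inv (\<gamma> x)"
    have "word_eval G \<gamma> (replicate (Suc n) (x, e)) = ?g \<otimes> ?g [^] n"
      by (simp only: replicate_Suc word_eval.simps Suc fst_conv snd_conv)
    also have "\<dots> = ?g [^] Suc n"
      by (rule nat_pow_Suc2[symmetric]) (simp add: gens)
    finally show ?case .
  qed simp
  show ?thesis
  proof (cases "0 \<le> k")
    case True
    then have "word_eval G \<gamma> (gen_pow x k) = \<gamma> x [^] nat k"
      unfolding gen_pow_def rep by simp
    also have "\<dots> = \<gamma> x [^] k"
      using True by (metis int_nat_eq int_pow_int)
    finally show ?thesis .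
  next
    case False
    then have "word_eval G \<gamma> (gen_pow x k) = inv (\<gamma> x) [^] nat (- k)"
      unfolding gen_pow_def rep by simp
    also have "\<dots> = inv (\<gamma> x [^] nat (- k))"
      by (rule nat_pow_inv[OF gens])
    also have "\<dots> = \<gamma> x [^] k"
      using False int_pow_neg_int[OF gens, of x "nat (- k)"] by (metis add.inverse_inverse int_nat_eq linear neg_0_le_iff_le)
    finally show ?thesis .
  qed
qed

lemma word_eval_pres_eq:
  assumes "\<And>l r. (l, r) \<in> R \<Longrightarrow> word_eval G \<gamma> l = word_eval G \<gamma> r" and "pres_eq R v w"
  shows "word_eval G \<gamma> v = word_eval G \<gamma> w"
  using assms(2)
proof (induction rule: pres_eq.induct)
  case (cancel u x e v)
  have "(if e then \<gamma> x else inv \<gamma> x) \<otimes> ((if \<not> e then \<gamma> x else inv \<gamma> x) \<otimes> word_eval G \<gamma> v) =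
      word_eval G \<gamma> v"
    by (cases e) (simp_all add: gens m_assoc[symmetric])
  then show ?case
    by (cases e) (simp_all add: word_eval_append gens)
qed (auto simp: word_eval_append assms(1))

end

end

lemma word_eval_presented_group:
  "word_eval (presented_group R) (\<lambda>x. pres_rel R `` {[(x, True)]}) w = pres_rel R `` {w}"
proof (induction w)
  case Nil
  then show ?case by (simp add: presented_group_def)
next
  case (Cons l w)
  interpret P: group "presented_group R" by (rule group_presented_group)
  obtain x e where l: "l = (x, e)" by (cases l)
  have "inv\<^bsub>presented_group R\<^esub> (pres_rel R `` {[(x, True)]}) = pres_rel R `` {[(x, False)]}"
  proof (rule P.inv_equality)
    show "pres_rel R `` {[(x, False)]} \<otimes>\<^bsub>presented_group R\<^esub> pres_rel R `` {[(x, True)]} =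
        \<one>\<^bsub>presented_group R\<^esub>"
      using pres_eq.cancel[of R "[]" x False "[]"]
      unfolding presented_group_mult by (simp add: pres_class_eq_iff presented_group_def)
  qed (auto simp: presented_group_def quotient_def)
  then show ?case
    using Cons by (auto simp: l presented_group_mult)
qed

lemma presented_group_carrier: "carrier (presented_group R) = range (\<lambda>w. pres_rel R `` {w})"
  by (auto simp: presented_group_def quotient_def)

text \<open>Injectivity is asked for words, where it can be checked on a normal form, rather than for classes.\<close>

lemma presented_group_iso:
  fixes \<gamma> :: "'g \<Rightarrow> 'a" and H :: "('a, 'b) monoid_scheme"
  assumes H: "group H" and gens: "\<And>x. \<gamma> x \<in> carrier H"
    and rels: "\<And>l r. (l, r) \<in> R \<Longrightarrow> word_eval H \<gamma> l = word_eval H \<gamma> r"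
    and surj: "carrier H \<subseteq> range (word_eval H \<gamma>)"
    and inj: "\<And>w. word_eval H \<gamma> w = \<one>\<^bsub>H\<^esub> \<Longrightarrow> pres_rel R `` {w} = \<one>\<^bsub>presented_group R\<^esub>"
  shows "presented_group R \<cong> H"
proof -
  interpret H: group H by fact
  interpret P: group "presented_group R" by (rule group_presented_group)
  note [simp] = H.word_eval_closed[of \<gamma>, OF gens]
  define h where "h = (\<lambda>X. word_eval H \<gamma> (SOME w. w \<in> X))"
  have h: "h (pres_rel R `` {w}) = word_eval H \<gamma> w" for w
  proof -
    have "w \<in> pres_rel R `` {w}" by (simp add: pres_rel_def pres_eq.refl)
    then have "(SOME w'. w' \<in> pres_rel R `` {w}) \<in> pres_rel R `` {w}" by (rule someI)
    then have "pres_eq R w (SOME w'. w' \<in> pres_rel R `` {w})" by (simp add: pres_rel_def)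
    then show ?thesis
      unfolding h_def using H.word_eval_pres_eq[of \<gamma> R, OF gens rels] by metis
  qed
  interpret h: group_hom "presented_group R" H h
    by unfold_locales (auto simp: hom_def presented_group_carrier presented_group_mult h
        H.word_eval_append[of \<gamma>, OF gens])
  have "inj_on h (carrier (presented_group R))"
    unfolding h.inj_on_one_iff
  proof (intro allI impI)
    fix X assume X: "X \<in> carrier (presented_group R)" "h X = \<one>\<^bsub>H\<^esub>"
    then obtain w where "X = pres_rel R `` {w}" unfolding presented_group_carrier by blast
    then show "X = \<one>\<^bsub>presented_group R\<^esub>" using X(2) inj[of w] by (simp only: h)
  qed
  moreover have "h ` carrier (presented_group R) = carrier H"
    using surj by (auto simp: presented_group_carrier image_image h gens)
  ultimately show ?thesis
    using h.homh by (auto simp: is_iso_def iso_def bij_betw_def)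
qed

section \<open>Words modulo the relations of \<open>G\<close>\<close>

context group
begin

lemma conj_int_pow:
  assumes "g \<in> carrier G" "x \<in> carrier G"
  shows "g \<otimes> x [^] (i :: int) \<otimes> inv g = (g \<otimes> x \<otimes> inv g) [^] i"
proof -
  have "inv g \<otimes> (g \<otimes> z) = z" if "z \<in> carrier G" for z
    using that assms by (simp flip: m_assoc)
  then interpret c: group_hom G G "\<lambda>x. g \<otimes> x \<otimes> inv g"
    by unfold_locales (use assms in \<open>auto simp: hom_def m_assoc\<close>)
  show ?thesis using assms by (simp add: c.hom_int_pow)
qed

lemma commute_int_pow:
  assumes "g \<in> carrier G" "x \<in> carrier G" "g \<otimes> x = x \<otimes> g"
  shows "g \<otimes> x [^] (i :: int) = x [^] i \<otimes> g"
proof -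
  have "g \<otimes> x \<otimes> inv g = x" using assms by (simp add: m_assoc)
  then have "g \<otimes> x [^] i \<otimes> inv g = x [^] i" using conj_int_pow[of g x i] assms by simp
  then show ?thesis using assms by (metis inv_closed int_pow_closed m_closed inv_solve_right inv_inv)
qed

text \<open>The set \<open>S\<close> of normal forms contains \<open>\<one>\<close> and is stable under left multiplication by \<open>B\<close>, \<open>C\<close> and
  their inverses, which commute, and by \<open>inv A\<close>, which can be moved past \<open>B ^ i \<otimes> C ^ j\<close> by the conjugation
  relations. The relations do not tell directly how \<open>A\<close> moves past \<open>B\<close> and \<open>C\<close>, but \<open>A\<close> is a natural power
  of \<open>inv A\<close> because it has finite order.\<close>

lemma word_eval_normal_form:
  fixes \<gamma> :: "gen \<Rightarrow> 'a" and D m n :: int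
  defines "A \<equiv> \<gamma> Gen_a" and "B \<equiv> \<gamma> Gen_b" and "C \<equiv> \<gamma> Gen_c"
  assumes gens: "\<And>x. \<gamma> x \<in> carrier G"
    and A: "A [^] (N :: nat) = \<one>" "N > 0"
    and BC: "B \<otimes> C = C \<otimes> B"
    and AB: "inv A \<otimes> B \<otimes> A = B [^] m \<otimes> C [^] (n * D)"
    and AC: "inv A \<otimes> C \<otimes> A = B [^] n \<otimes> C [^] m"
  shows "\<exists>(i :: int) (j :: int) (k :: int). word_eval G \<gamma> w = B [^] i \<otimes> C [^] j \<otimes> A [^] k"
proof -
  define S where "S = {z. \<exists>(i :: int) (j :: int) (k :: int). z = B [^] i \<otimes> C [^] j \<otimes> A [^] k}"
  define U where "U = {g \<in> carrier G. \<forall>z\<in>S. g \<otimes> z \<in> S}"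
  have cl [simp]: "A \<in> carrier G" "B \<in> carrier G" "C \<in> carrier G"
    by (simp_all add: A_def B_def C_def gens)
  have comm: "C [^] j \<otimes> B [^] i = B [^] i \<otimes> C [^] j" for i j :: int
  proof -
    have "C \<otimes> B [^] i = B [^] i \<otimes> C" using BC by (intro commute_int_pow) auto
    then have "B [^] i \<otimes> C [^] j = C [^] j \<otimes> B [^] i" by (intro commute_int_pow) auto
    then show ?thesis by simp
  qed
  have merge: "(B [^] i \<otimes> C [^] j) \<otimes> (B [^] i' \<otimes> C [^] j') = B [^] (i + i') \<otimes> C [^] (j + j')"
    for i j i' j' :: int
  proof -
    have "(B [^] i \<otimes> C [^] j) \<otimes> (B [^] i' \<otimes> C [^] j') =
        B [^] i \<otimes> (C [^] j \<otimes> B [^] i') \<otimes> C [^] j'"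
      by (simp add: m_assoc)
    also have "\<dots> = (B [^] i \<otimes> B [^] i') \<otimes> (C [^] j \<otimes> C [^] j')"
      unfolding comm by (simp add: m_assoc)
    finally show ?thesis by (simp add: int_pow_mult)
  qed
  have power: "(B [^] i \<otimes> C [^] j) [^] k = B [^] (i * k) \<otimes> C [^] (j * k)" for i j k :: int
    by (subst int_pow_mult_distrib) (simp_all add: comm int_pow_pow)
  have S_U: "g \<in> U" if "g \<in> carrier G"
    and "\<And>(i :: int) (j :: int) (k :: int). g \<otimes> (B [^] i \<otimes> C [^] j \<otimes> A [^] k) \<in> S" for g
    unfolding U_def
  proof (intro CollectI conjI ballI)
    fix z assume "z \<in> S"
    then obtain i j k :: int where "z = B [^] i \<otimes> C [^] j \<otimes> A [^] k" unfolding S_def by blast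
    then show "g \<otimes> z \<in> S" using that(2) by simp
  qed (rule that(1))
  have U_closed: "g \<otimes> h \<in> U" if "g \<in> U" "h \<in> U" for g h
  proof -
    have "g \<otimes> h \<otimes> z \<in> S" if z: "z \<in> S" for z
    proof -
      have "z \<in> carrier G" using z by (auto simp: S_def)
      then have "g \<otimes> h \<otimes> z = g \<otimes> (h \<otimes> z)"
        using \<open>g \<in> U\<close> \<open>h \<in> U\<close> by (simp add: U_def m_assoc)
      then show ?thesis using \<open>g \<in> U\<close> \<open>h \<in> U\<close> z by (simp add: U_def)
    qed
    then show ?thesis using that by (simp add: U_def)
  qed
  have BC_U: "B [^] i' \<otimes> C [^] j' \<in> U" for i' j' :: int
  proof (rule S_U)
    fix i j k :: int
    have "(B [^] i' \<otimes> C [^] j') \<otimes> (B [^] i \<otimes> C [^] j \<otimes> A [^] k) =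
        B [^] (i' + i) \<otimes> C [^] (j' + j) \<otimes> A [^] k"
      by (simp flip: merge add: m_assoc)
    then show "B [^] i' \<otimes> C [^] j' \<otimes> (B [^] i \<otimes> C [^] j \<otimes> A [^] k) \<in> S"
      unfolding S_def by blast
  qed simp
  have one_U: "\<one> \<in> U"
  proof (rule S_U)
    fix i j k :: int
    have "\<one> \<otimes> (B [^] i \<otimes> C [^] j \<otimes> A [^] k) = B [^] i \<otimes> C [^] j \<otimes> A [^] k" by simp
    then show "\<one> \<otimes> (B [^] i \<otimes> C [^] j \<otimes> A [^] k) \<in> S" unfolding S_def by blast
  qed simp
  have invA_U: "inv A \<in> U"
  proof (rule S_U)
    fix i j k :: int
    have B: "inv A \<otimes> B [^] i \<otimes> A = B [^] (m * i) \<otimes> C [^] (n * D * i)"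
      using conj_int_pow[of "inv A" B i] AB by (simp add: power)
    have C: "inv A \<otimes> C [^] j \<otimes> A = B [^] (n * j) \<otimes> C [^] (m * j)"
      using conj_int_pow[of "inv A" C j] AC by (simp add: power)
    have "A \<otimes> (inv A \<otimes> z) = z" if "z \<in> carrier G" for z
      using that by (simp flip: m_assoc)
    then have "inv A \<otimes> (B [^] i \<otimes> C [^] j \<otimes> A [^] k) =
        (inv A \<otimes> B [^] i \<otimes> A) \<otimes> (inv A \<otimes> C [^] j \<otimes> A) \<otimes> (inv A \<otimes> A [^] k)"
      by (simp add: m_assoc)
    also have "inv A \<otimes> A [^] k = A [^] (k - 1)"
      using int_pow_mult[of A "-1" k] by (simp add: int_pow_neg)
    finally have "inv A \<otimes> (B [^] i \<otimes> C [^] j \<otimes> A [^] k) =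
        B [^] (m * i + n * j) \<otimes> C [^] (n * D * i + m * j) \<otimes> A [^] (k - 1)"
      unfolding B C merge .
    then show "inv A \<otimes> (B [^] i \<otimes> C [^] j \<otimes> A [^] k) \<in> S"
      unfolding S_def by blast
  qed simp
  have "inv A [^] k \<in> U" for k :: nat
    by (induction k) (auto intro: U_closed one_U invA_U)
  moreover have "inv A [^] (N - 1) = A"
  proof -
    have "inv A [^] (N - 1) \<otimes> inv A = inv A [^] N"
      using A(2) by (metis Suc_diff_1 nat_pow_Suc)
    also have "\<dots> = \<one>" using A(1) by (simp add: nat_pow_inv)
    finally show ?thesis using inv_equality[of "inv A [^] (N - 1)" "inv A"] by simp
  qed
  ultimately have A_U: "A \<in> U" by metis
  have letters: "\<gamma> x \<in> U" "inv (\<gamma> x) \<in> U" for x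
  proof -
    have "B \<in> U" "C \<in> U" "inv B \<in> U" "inv C \<in> U"
      using BC_U[of 1 0] BC_U[of 0 1] BC_U[of "-1" 0] BC_U[of 0 "-1"] by (simp_all add: int_pow_neg)
    with A_U invA_U show "\<gamma> x \<in> U" "inv (\<gamma> x) \<in> U"
      by (cases x; simp add: A_def B_def C_def)+
  qed
  have "word_eval G \<gamma> w \<in> U"
    by (induction w) (auto intro!: U_closed one_U letters)
  moreover have "\<one> \<in> S"
    unfolding S_def by (intro CollectI exI[of _ 0]) simp
  ultimately have "word_eval G \<gamma> w \<otimes> \<one> \<in> S" unfolding U_def by blast
  then have "word_eval G \<gamma> w \<in> S" using word_eval_closed[of \<gamma>, OF gens] by simp
  then show ?thesis unfolding S_def by blast
qed

lemma word_eval_G_relations: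
  fixes \<gamma> :: "gen \<Rightarrow> 'a" and p q :: nat and D m n :: int
  defines "A \<equiv> \<gamma> Gen_a" and "B \<equiv> \<gamma> Gen_b" and "C \<equiv> \<gamma> Gen_c"
  assumes gens: "\<And>x. \<gamma> x \<in> carrier G"
  shows "(\<forall>(l, r) \<in> G_relations p q D m n. word_eval G \<gamma> l = word_eval G \<gamma> r) \<longleftrightarrow>
    A [^] (q\<^sup>2) = \<one> \<and> B [^] p = \<one> \<and> C [^] p = \<one> \<and> B \<otimes> C = C \<otimes> B \<and>
    inv A \<otimes> B \<otimes> A = B [^] m \<otimes> C [^] (n * D) \<and> inv A \<otimes> C \<otimes> A = B [^] n \<otimes> C [^] m"
proof -
  have cl: "A \<in> carrier G" "B \<in> carrier G" "C \<in> carrier G"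
    by (simp_all add: A_def B_def C_def gens)
  have "inv B \<otimes> inv C \<otimes> (B \<otimes> C) = \<one> \<longleftrightarrow> B \<otimes> C = C \<otimes> B"
    using cl by (metis inv_closed inv_mult_group inv_solve_left m_closed r_one one_closed)
  then have c: "inv B \<otimes> (inv C \<otimes> (B \<otimes> C)) = \<one> \<longleftrightarrow> B \<otimes> C = C \<otimes> B"
    using cl by (simp add: m_assoc)
  show ?thesis
    using cl by (simp add: G_relations_def comm_word_def word_eval_append[of \<gamma>, OF gens]
        word_eval_inv_word[of \<gamma>, OF gens] word_eval_gen_pow[of \<gamma>, OF gens] int_pow_int
        int_pow_neg c m_assoc flip: A_def B_def C_def del: of_nat_power)
qed

end

section \<open>Quadratic extensions of prime fields\<close>

lemma (in ring) of_int_eq_add_pow: "[k] \<cdot> \<one> = \<guillemotleft>k\<guillemotright>" for k :: int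
proof -
  have "[n] \<cdot> \<one> = \<guillemotleft>n\<guillemotright>\<^sub>\<nat>" for n :: nat
    by (induction n) (simp_all add: add.nat_pow_Suc a_comm)
  then show ?thesis
    by (cases "k \<ge> 0") (simp_all add: add_pow_int_ge add_pow_int_lt of_integer_def)
qed

locale quadratic_extension = field K for K (structure) +
  fixes p :: nat and D :: int and s
  assumes p: "prime p" and nonsquare: "\<not> QuadRes (int p) D"
    and order_K: "order K = p\<^sup>2"
    and s [simp]: "s \<in> carrier K" and s_square: "s \<otimes> s = \<guillemotleft>D\<guillemotright>"
begin

text \<open>Coordinates with respect to the basis \<open>1, s\<close>, given by integer representatives. Identities in \<open>K\<close>
  become congruences between integers.\<close>

definition el :: "int \<Rightarrow> int \<Rightarrow> 'a"
  where "el a b = \<guillemotleft>a\<guillemotright> \<oplus> \<guillemotleft>b\<guillemotright> \<otimes> s"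

lemma finite_K: "finite (carrier K)"
  using order_K p by (intro card_ge_0_finite) (simp add: order_def prime_gt_0_nat)

text \<open>The additive group of \<open>K\<close> has order \<open>p^2\<close>, so \<open>p^2\<close>, and hence \<open>p\<close>, vanishes in \<open>K\<close>.\<close>

lemma of_int_eq_0_iff: "\<guillemotleft>k\<guillemotright> = \<zero> \<longleftrightarrow> int p dvd k"
proof -
  have "[order K] \<cdot> \<one> = \<zero>"
    using add.pow_order_eq_1[of \<one>] by (simp add: order_def)
  then have "\<guillemotleft>int (p\<^sup>2)\<guillemotright> = \<zero>"
    by (simp add: of_int_eq_add_pow[symmetric] add_pow_int_ge order_K nat_power_eq)
  then have "\<guillemotleft>int p\<guillemotright> \<otimes> \<guillemotleft>int p\<guillemotright> = \<zero>"
    by (simp add: monoid_mult_class.power2_eq_square flip: of_int_mult)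
  then have p0: "\<guillemotleft>int p\<guillemotright> = \<zero>"
    by (metis integral of_int_closed)
  show ?thesis
  proof
    assume "int p dvd k"
    then show "\<guillemotleft>k\<guillemotright> = \<zero>" using p0 by (auto elim!: dvdE)
  next
    assume k: "\<guillemotleft>k\<guillemotright> = \<zero>"
    show "int p dvd k"
    proof (rule ccontr)
      assume "\<not> int p dvd k"
      then have "coprime (int p) k"
        using p by (simp add: prime_imp_coprime)
      then obtain u v where "u * int p + v * k = 1"
        by (metis bezout_int coprime_iff_gcd_eq_1)
      then have "\<guillemotleft>1\<guillemotright> = \<guillemotleft>u\<guillemotright> \<otimes> \<guillemotleft>int p\<guillemotright> \<oplus> \<guillemotleft>v\<guillemotright> \<otimes> \<guillemotleft>k\<guillemotright>"
        by (metis of_int_add of_int_mult)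
      then show False using k p0 by simp
    qed
  qed
qed

lemma el_closed [simp]: "el a b \<in> carrier K"
  by (simp add: el_def)

lemma el_add: "el a b \<oplus> el a' b' = el (a + a') (b + b')"
proof -
  have "(x \<oplus> y \<otimes> t) \<oplus> (x' \<oplus> y' \<otimes> t) = (x \<oplus> x') \<oplus> (y \<oplus> y') \<otimes> t"
    if "x \<in> carrier K" "y \<in> carrier K" "x' \<in> carrier K" "y' \<in> carrier K" "t \<in> carrier K"
    for x y x' y' t
    using that by (simp add: l_distr a_ac)
  then show ?thesis by (simp add: el_def)
qed

lemma el_minus: "\<ominus> el a b = el (- a) (- b)"
  by (simp add: el_def minus_add l_minus)

lemma el_mult: "el a b \<otimes> el a' b' = el (a * a' + b * b' * D) (a * b' + a' * b)"
proof -
  have "(x \<oplus> y \<otimes> t) \<otimes> (x' \<oplus> y' \<otimes> t) = (x \<otimes> x' \<oplus> y \<otimes> y' \<otimes> d) \<oplus> (x \<otimes> y' \<oplus> x' \<otimes> y) \<otimes> t"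
    if "x \<in> carrier K" "y \<in> carrier K" "x' \<in> carrier K" "y' \<in> carrier K" "t \<in> carrier K"
      "d \<in> carrier K" and td: "t \<otimes> t = d"
    for x y x' y' t d
    using that(1-5) by (simp add: l_distr r_distr a_ac m_ac flip: td)
  from this[of "\<guillemotleft>a\<guillemotright>" "\<guillemotleft>b\<guillemotright>" "\<guillemotleft>a'\<guillemotright>" "\<guillemotleft>b'\<guillemotright>" s "\<guillemotleft>D\<guillemotright>"] show ?thesis
    by (simp add: el_def s_square)
qed

text \<open>The norm \<open>a^2 - b^2 D\<close> of a vanishing element vanishes; if \<open>b\<close> were invertible modulo \<open>p\<close>, then
  \<open>D\<close> would be the square of \<open>a / b\<close>.\<close>

lemma el_eq_0_iff: "el a b = \<zero> \<longleftrightarrow> int p dvd a \<and> int p dvd b"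
proof
  assume 0: "el a b = \<zero>"
  have "el (a\<^sup>2 - b\<^sup>2 * D) 0 = el a b \<otimes> el a (- b)"
    by (simp add: el_mult monoid_mult_class.power2_eq_square)
  then have "\<guillemotleft>a\<^sup>2 - b\<^sup>2 * D\<guillemotright> = \<zero>"
    by (simp add: 0 del: of_int_diff) (simp add: el_def del: of_int_diff)
  then have N: "int p dvd a\<^sup>2 - b\<^sup>2 * D"
    unfolding of_int_eq_0_iff .
  have b: "int p dvd b"
  proof (rule ccontr)
    assume "\<not> int p dvd b"
    then have "coprime b (int p)"
      using p by (metis prime_imp_coprime coprime_commute prime_nat_int_transfer)
    then obtain c where c: "[b * c = 1] (mod int p)"
      using cong_solve_coprime_int by blast
    have "[a\<^sup>2 = b\<^sup>2 * D] (mod int p)"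
      using N by (simp add: cong_iff_dvd_diff)
    then have "[(a * c)\<^sup>2 = (b * c)\<^sup>2 * D] (mod int p)"
      using cong_mult[of "a\<^sup>2" "b\<^sup>2 * D" "int p" "c\<^sup>2" "c\<^sup>2"]
      by (simp add: power_mult_distrib mult_ac)
    also have "[(b * c)\<^sup>2 * D = 1\<^sup>2 * D] (mod int p)"
      using c by (intro cong_mult cong_pow) auto
    finally have "QuadRes (int p) D"
      by (auto simp: QuadRes_def)
    then show False using nonsquare by simp
  qed
  with 0 have "\<guillemotleft>a\<guillemotright> = \<zero>"
    by (simp add: el_def of_int_eq_0_iff[THEN iffD2])
  with b show "int p dvd a \<and> int p dvd b"
    by (simp add: of_int_eq_0_iff)
qed (simp add: el_def of_int_eq_0_iff[THEN iffD2])

lemma el_eq_iff: "el a b = el a' b' \<longleftrightarrow> [a = a'] (mod int p) \<and> [b = b'] (mod int p)"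
proof -
  have "el a b = el a' b' \<longleftrightarrow> el a b \<oplus> \<ominus> el a' b' = \<zero>"
    using r_right_minus_eq[of "el a b" "el a' b'"] by (simp add: minus_eq)
  also have "\<dots> \<longleftrightarrow> el (a - a') (b - b') = \<zero>"
    by (simp add: el_minus el_add)
  finally show ?thesis by (simp add: el_eq_0_iff cong_iff_dvd_diff)
qed

lemma el_inj_on: "inj_on (\<lambda>(a, b). el a b) ({0..<int p} \<times> {0..<int p})"
  by (auto simp: inj_on_def el_eq_iff cong_def)

text \<open>A count: there are \<open>p^2\<close> pairs of coordinates and \<open>p^2\<close> elements of \<open>K\<close>.\<close>

lemma el_image: "(\<lambda>(a, b). el a b) ` ({0..<int p} \<times> {0..<int p}) = carrier K"
proof (rule card_subset_eq)
  show "card ((\<lambda>(a, b). el a b) ` ({0..<int p} \<times> {0..<int p})) = card (carrier K)"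
    using order_K by (simp add: card_image[OF el_inj_on] order_def monoid_mult_class.power2_eq_square)
qed (auto simp: finite_K)

lemma el_cases:
  assumes "x \<in> carrier K"
  obtains a b where "x = el a b"
  using assms unfolding el_image[symmetric] by auto

lemma s_eq_el: "s = el 0 1" and one_eq_el: "\<one> = el 1 0" and zero_eq_el: "\<zero> = el 0 0"
  by (auto simp: el_def of_integer_def)

text \<open>The nontrivial field automorphism, which could also be written \<open>x \<mapsto> x ^ p\<close>. In coordinates its
  additivity and its effect on integers are immediate.\<close>

definition conjg :: "'a \<Rightarrow> 'a"
  where "conjg x = (SOME y. \<exists>a b. x = el a b \<and> y = el a (- b))"

lemma conjg_el [simp]: "conjg (el a b) = el a (- b)"
proof -
  have "\<exists>a' b'. el a b = el a' b' \<and> conjg (el a b) = el a' (- b')"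
    unfolding conjg_def by (rule someI[of _ "el a (- b)"]) auto
  then show ?thesis by (auto simp: el_eq_iff cong_minus_minus_iff cong_sym)
qed

lemma conjg_closed [simp]: "x \<in> carrier K \<Longrightarrow> conjg x \<in> carrier K"
  by (erule el_cases) auto

lemma conjg_conjg: "x \<in> carrier K \<Longrightarrow> conjg (conjg x) = x"
  by (erule el_cases) auto

lemma conjg_add: "x \<in> carrier K \<Longrightarrow> y \<in> carrier K \<Longrightarrow> conjg (x \<oplus> y) = conjg x \<oplus> conjg y"
  by (erule el_cases, erule el_cases) (auto simp: el_add)

lemma conjg_mult: "x \<in> carrier K \<Longrightarrow> y \<in> carrier K \<Longrightarrow> conjg (x \<otimes> y) = conjg x \<otimes> conjg y"
  by (erule el_cases, erule el_cases) (auto simp: el_mult)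

lemma conjg_one [simp]: "conjg \<one> = \<one>"
  by (simp add: one_eq_el)

lemma p_odd: "odd p"
proof
  assume "even p"
  then have "p = 2" using p primes_dvd_imp_eq two_is_prime_nat by blast
  then have "[D\<^sup>2 = D] (mod int p)" by (simp add: cong_def mod2_eq_if)
  then show False using nonsquare by (auto simp: QuadRes_def)
qed

end

section \<open>Semilinear maps of a quadratic extension\<close>

context quadratic_extension
begin

lemma el_cmult: "el k 0 \<otimes> el a b = el (k * a) (k * b)"
  by (simp add: el_mult)

lemma D_nonzero: "\<not> int p dvd D"
proof
  assume "int p dvd D"
  then have "[0\<^sup>2 = D] (mod int p)" by (simp add: cong_iff_dvd_diff)
  then have "QuadRes (int p) D" unfolding QuadRes_def by blast
  then show False using nonsquare by simp
qed

lemma additive_scale: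
  assumes f: "f \<in> carrier K \<rightarrow> carrier K"
    and add: "\<And>x y. x \<in> carrier K \<Longrightarrow> y \<in> carrier K \<Longrightarrow> f (x \<oplus> y) = f x \<oplus> f y"
    and x: "x \<in> carrier K"
  shows "f (el k 0 \<otimes> x) = el k 0 \<otimes> f x"
proof -
  have fx: "f x \<in> carrier K" using f x by auto
  have "f \<zero> \<oplus> f \<zero> = f \<zero>" using add[of \<zero> \<zero>] by simp
  moreover have "f \<zero> \<in> carrier K" using f by auto
  ultimately have f0: "f \<zero> = \<zero>" using add.r_cancel_one' by metis
  have nat: "f (el (int j) 0 \<otimes> x) = el (int j) 0 \<otimes> f x" for j
  proof (induction j)
    case 0
    then show ?case using f0 fx x by (simp flip: zero_eq_el)
  next
    case (Suc j)
    have "el (int (Suc j)) 0 = el (int j) 0 \<oplus> \<one>"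
      by (simp add: one_eq_el el_add add.commute)
    then show ?case using Suc x fx by (simp add: l_distr add)
  qed
  have "el k 0 = el (int (nat (k mod int p))) 0"
    using p by (simp add: el_eq_iff prime_gt_0_nat)
  then show ?thesis using nat by metis
qed

lemma square_cong_1:
  assumes "[d\<^sup>2 = 1] (mod int p)"
  shows "[d = 1] (mod int p) \<or> [d = -1] (mod int p)"
proof -
  have "int p dvd (d - 1) * (d + 1)"
    using assms by (simp add: cong_iff_dvd_diff algebra_simps monoid_mult_class.power2_eq_square)
  then show ?thesis
    using p by (auto simp: prime_dvd_mult_iff cong_iff_dvd_diff)
qed

text \<open>After division by \<open>f 1\<close> the map fixes the prime field, and it is determined by the image
  \<open>el c d\<close> of \<open>s\<close>. Evaluating the hypothesis at \<open>1\<close> gives \<open>E = m + n (c + d s)\<close>, and evaluating it at \<open>s\<close>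
  gives \<open>2 c d = 0\<close> and \<open>c^2 + d^2 D = D\<close> modulo \<open>p\<close>. As \<open>D\<close> is not a square, \<open>d\<close> is nonzero; so \<open>c = 0\<close> and
  \<open>d = \<plusminus>1\<close>, which are the two alternatives.\<close>

lemma semilinear_cases:
  assumes f: "f \<in> carrier K \<rightarrow> carrier K"
    and add: "\<And>x y. x \<in> carrier K \<Longrightarrow> y \<in> carrier K \<Longrightarrow> f (x \<oplus> y) = f x \<oplus> f y"
    and n: "\<not> int p dvd n" and E: "E \<in> carrier K"
    and semi: "\<And>x. x \<in> carrier K \<Longrightarrow> f (el m n \<otimes> x) = E \<otimes> f x"
    and nz: "f \<one> \<noteq> \<zero>"
  shows "E = el m n \<and> (\<forall>x\<in>carrier K. f x = f \<one> \<otimes> x) \<or>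
         E = conjg (el m n) \<and> (\<forall>x\<in>carrier K. f x = f \<one> \<otimes> conjg x)"
proof -
  define u where "u = f \<one>"
  have u: "u \<in> carrier K" "u \<noteq> \<zero>" using f nz by (auto simp: u_def)
  have fc: "f x \<in> carrier K" if "x \<in> carrier K" for x using f that by auto
  have iu: "inv u \<in> carrier K" "u \<otimes> inv u = \<one>"
    using u by (auto simp: field_Units)
  obtain c d where cd: "inv u \<otimes> f s = el c d"
    using iu fc[OF s] by (meson el_cases m_closed)
  have "u \<otimes> el c d = (u \<otimes> inv u) \<otimes> f s"
    unfolding cd[symmetric] using u(1) iu(1) fc[OF s] by (rule m_assoc[symmetric])
  then have fs: "f s = u \<otimes> el c d" using iu fc[OF s] by simp
  have fel: "f (el a b) = u \<otimes> (el (a + b * c) (b * d))" for a b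
  proof -
    have "el a b = el a 0 \<otimes> \<one> \<oplus> el b 0 \<otimes> s"
      by (simp add: el_def)
    then have "f (el a b) = f (el a 0 \<otimes> \<one> \<oplus> el b 0 \<otimes> s)"
      by (rule arg_cong)
    also have "\<dots> = el a 0 \<otimes> u \<oplus> el b 0 \<otimes> f s"
      by (simp add: add additive_scale[OF f add] u_def del: r_one)
    also have "\<dots> = u \<otimes> (el a 0 \<oplus> el b 0 \<otimes> el c d)"
      using u by (simp add: fs r_distr m_ac)
    finally show ?thesis by (simp add: el_cmult el_add)
  qed
  have "u \<otimes> el (m + n * c) (n * d) = u \<otimes> E"
    using semi[of \<one>] E u by (simp add: fel m_comm flip: u_def)
  then have E_el: "E = el (m + n * c) (n * d)"
    using u E by (simp add: m_lcancel)
  have "el m n \<otimes> s = el (n * D) m"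
    using el_mult[of m n 0 1] s_eq_el by simp
  then have "u \<otimes> el (n * D + m * c) (m * d) = u \<otimes> (E \<otimes> el c d)"
    using semi[of s] E u by (simp add: fel fs m_lcomm)
  then have "el (n * D + m * c) (m * d) = E \<otimes> el c d"
    using u E by (simp add: m_lcancel)
  then have 1: "int p dvd (n * D + m * c) - ((m + n * c) * c + n * d * d * D)"
    and 2: "int p dvd m * d - ((m + n * c) * d + c * (n * d))"
    by (simp_all add: E_el el_mult el_eq_iff cong_iff_dvd_diff)
  have "int p dvd n * (2 * (c * d))"
    using 2 by (simp add: algebra_simps)
  then have "int p dvd 2 \<or> int p dvd c \<or> int p dvd d"
    using p n by (simp add: prime_dvd_mult_iff)
  moreover have "\<not> int p dvd 2"
    using p p_odd by (metis dvd_imp_le int_dvd_int_iff of_nat_numeral prime_ge_2_nat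
        le_antisym zero_less_numeral even_numeral)
  ultimately have cd0: "int p dvd c \<or> int p dvd d" by blast
  have "int p dvd n * (D - c\<^sup>2 - d\<^sup>2 * D)"
    using 1 by (simp add: algebra_simps monoid_mult_class.power2_eq_square)
  then have 3: "int p dvd D - c\<^sup>2 - d\<^sup>2 * D"
    using p n by (simp add: prime_dvd_mult_iff)
  have "\<not> int p dvd d"
  proof
    assume "int p dvd d"
    then have "int p dvd d\<^sup>2 * D" by (simp add: monoid_mult_class.power2_eq_square)
    then have "int p dvd D - c\<^sup>2" using dvd_add[OF 3] by fastforce
    then have "[c\<^sup>2 = D] (mod int p)" by (simp add: cong_iff_dvd_diff dvd_diff_commute)
    then show False using nonsquare by (auto simp: QuadRes_def)
  qed
  then have c: "int p dvd c" using cd0 by blast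
  then have "int p dvd c\<^sup>2" by (simp add: monoid_mult_class.power2_eq_square)
  then have "int p dvd D - d\<^sup>2 * D"
    using dvd_add[OF 3] by fastforce
  then have "int p dvd (d\<^sup>2 - 1) * D"
    by (simp add: left_diff_distrib dvd_diff_commute)
  then have "[d\<^sup>2 = 1] (mod int p)"
    using p D_nonzero by (simp add: prime_dvd_mult_iff cong_iff_dvd_diff)
  then consider "[d = 1] (mod int p)" | "[d = -1] (mod int p)"
    using square_cong_1 by blast
  then show ?thesis
  proof cases
    case 1
    have el1: "el (a + b * c) (b * d) = el a b" for a b
      using cong_add[OF cong_refl[of a] cong_mult[OF cong_refl[of b]], of c 0 "int p"]
        cong_mult[OF cong_refl[of b] 1] c
      by (simp add: el_eq_iff cong_0_iff)
    have "\<forall>x\<in>carrier K. f x = u \<otimes> x"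
    proof
      fix x assume "x \<in> carrier K"
      then obtain a b where "x = el a b" by (rule el_cases)
      then show "f x = u \<otimes> x" by (simp add: fel el1)
    qed
    moreover have "E = el m n" using E_el el1 by simp
    ultimately show ?thesis unfolding u_def by blast
  next
    case 2
    have el2: "el (a + b * c) (b * d) = el a (- b)" for a b
      using cong_add[OF cong_refl[of a] cong_mult[OF cong_refl[of b]], of c 0 "int p"]
        cong_mult[OF cong_refl[of b] 2] c
      by (simp add: el_eq_iff cong_0_iff)
    have "\<forall>x\<in>carrier K. f x = u \<otimes> conjg x"
    proof
      fix x assume "x \<in> carrier K"
      then obtain a b where "x = el a b" by (rule el_cases)
      then show "f x = u \<otimes> conjg x" by (simp add: fel el2)
    qed
    moreover have "E = conjg (el m n)" using E_el el2 by simp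
    ultimately show ?thesis unfolding u_def by blast
  qed
qed

end

section \<open>The root of unity\<close>

text \<open>Here \<open>w\<close> is any \<open>q\<close>-th root of unity outside the prime field.\<close>

locale twisting_unit = quadratic_extension +
  fixes q :: nat and m n :: int and w
  assumes q: "prime q" and pq: "p \<noteq> q" and q_dvd: "q dvd p + 1"
    and n: "\<not> int p dvd n" and w_el: "w = el m n" and w_pow: "w [^] q = \<one>"
begin

sublocale M: group "mult_of K"
  by (rule field_mult_group)

lemma w_closed [simp]: "w \<in> carrier K" by (simp add: w_el)

lemma w_nonzero [simp]: "w \<noteq> \<zero>"
  using n by (simp add: w_el el_eq_0_iff)

text \<open>The square roots of \<open>1\<close> lie in the prime field.\<close>

lemma q_odd: "odd q"
proof
  assume "even q"
  then have "q = 2" using q primes_dvd_imp_eq two_is_prime_nat by blast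
  then have ww: "w \<otimes> w = \<one>" using w_pow by (simp add: numeral_2_eq_2 m_assoc)
  have "el (m - 1) n \<otimes> el (m + 1) n = w \<otimes> w \<oplus> el (-1) 0"
    by (simp add: w_el el_mult el_add algebra_simps)
  also have "\<dots> = \<zero>"
    by (simp add: ww one_eq_el zero_eq_el el_add)
  finally have "el (m - 1) n = \<zero> \<or> el (m + 1) n = \<zero>"
    by (metis integral el_closed)
  then show False using n by (auto simp: el_eq_0_iff)
qed

lemma q_coprime: "coprime q (p - 1)"
proof -
  have "\<not> q dvd p - 1"
  proof
    assume "q dvd p - 1"
    then have "q dvd (p + 1) - (p - 1)" using q_dvd by (rule dvd_diff_nat[rotated])
    moreover have "(p + 1) - (p - 1) = 2" using p prime_gt_0_nat[of p] by linarith
    ultimately have "q dvd 2" by metis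
    then show False using q q_odd by (metis dvd_antisym even_numeral primes_dvd_imp_eq two_is_prime_nat dvd_refl)
  qed
  then show ?thesis using q by (simp add: prime_imp_coprime)
qed

text \<open>The norm of \<open>w\<close> is an integer \<open>k\<close> modulo \<open>p\<close> with \<open>k^q = 1\<close>. By Fermat's little theorem also
  \<open>k^(p - 1) = 1\<close>, and the two exponents are coprime.\<close>

lemma norm_w: "w \<otimes> conjg w = \<one>"
proof -
  define r where "r = m\<^sup>2 - n\<^sup>2 * D"
  define k where "k = nat (r mod int p)"
  have p0: "p > 0" using p by (rule prime_gt_0_nat)
  have k: "int k = r mod int p" using p0 by (simp add: k_def)
  have "w \<otimes> conjg w = el r 0"
    by (simp add: w_el el_mult r_def monoid_mult_class.power2_eq_square algebra_simps)
  also have "\<dots> = el (int k) 0" using p0 by (simp add: el_eq_iff k)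
  finally have wk: "w \<otimes> conjg w = el (int k) 0" .
  have pw: "el (int k) 0 [^] j = el (int (k ^ j)) 0" for j :: nat
    by (induction j) (simp_all add: one_eq_el el_mult mult.commute)
  have "conjg (w [^] j) = conjg w [^] j" for j :: nat
    by (induction j) (simp_all add: conjg_mult)
  then have "conjg w [^] q = \<one>" using w_pow by (metis conjg_one)
  then have "(w \<otimes> conjg w) [^] q = \<one>"
    using w_pow by (simp add: nat_pow_distrib)
  then have "el (int (k ^ q)) 0 = el 1 0"
    by (simp add: wk pw one_eq_el)
  then have "[int (k ^ q) = int 1] (mod int p)"
    by (simp add: el_eq_iff)
  then have kq: "[k ^ q = 1] (mod p)"
    by (simp only: cong_int_iff)
  have "\<not> p dvd k"
  proof
    assume "p dvd k"
    then have "p dvd k ^ q" using q by (simp add: prime_gt_0_nat dvd_power_iff dvd_trans[OF _ dvd_power])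
    then have "p dvd 1" using kq by (simp add: cong_dvd_iff)
    then show False using p by (simp add: prime_gt_Suc_0_nat)
  qed
  then have k1: "[k ^ (p - 1) = 1] (mod p)"
    using p by (rule fermat_theorem[rotated])
  obtain a b where ab: "q * a = (p - 1) * b + 1"
    using bezout_nat[of q "p - 1"] q q_coprime by (auto simp: prime_gt_0_nat)
  have "[(k ^ q) ^ a = 1 ^ a] (mod p)" using kq by (rule cong_pow)
  moreover have "[(k ^ (p - 1)) ^ b * k = 1 ^ b * k] (mod p)"
    using k1 by (intro cong_mult cong_pow) auto
  moreover have "(k ^ q) ^ a = (k ^ (p - 1)) ^ b * k"
    by (simp add: ab flip: power_mult)
  ultimately have "[k = 1] (mod p)"
    by (metis cong_sym cong_trans mult_1 power_one)
  then have "[int k = int 1] (mod int p)"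
    by (simp only: cong_int_iff)
  then show ?thesis by (simp add: wk one_eq_el el_eq_iff)
qed

definition wpow :: "int \<Rightarrow> 'a"
  where "wpow i = w [^]\<^bsub>mult_of K\<^esub> i"

lemma w_M [simp]: "w \<in> carrier (mult_of K)" by simp

lemma wpow_M: "wpow i \<in> carrier (mult_of K)"
  unfolding wpow_def by (rule M.int_pow_closed) simp

lemma wpow_closed [simp]: "wpow i \<in> carrier K" and wpow_nonzero [simp]: "wpow i \<noteq> \<zero>"
  using wpow_M[of i] by auto

lemma wpow_0 [simp]: "wpow 0 = \<one>" by (simp add: wpow_def)

lemma wpow_1 [simp]: "wpow 1 = w"
  unfolding wpow_def by (rule M.int_pow_1) simp

lemma wpow_add: "wpow (i + j) = wpow i \<otimes> wpow j"
  unfolding wpow_def using M.int_pow_mult[of w i j] by simp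

lemma wpow_mult: "wpow (i * j) = wpow i [^]\<^bsub>mult_of K\<^esub> j"
  unfolding wpow_def using M.int_pow_pow[of w i j] by (simp add: mult.commute)

lemma w_neq_one: "w \<noteq> \<one>"
  using n by (simp add: w_el one_eq_el el_eq_iff cong_0_iff)

lemma wpow_eq_1_iff: "wpow i = \<one> \<longleftrightarrow> int q dvd i"
proof -
  have eq: "wpow (int q) = \<one>"
    using w_pow by (simp add: wpow_def int_pow_int nat_pow_mult_of)
  have dvd: "wpow i = \<one>" if "int q dvd i" for i
  proof -
    from that obtain c where "i = int q * c" ..
    then show ?thesis using eq M.int_pow_one[of c] by (simp add: wpow_mult)
  qed
  show ?thesis
  proof
    assume i: "wpow i = \<one>"
    show "int q dvd i"
    proof (rule ccontr)
      assume "\<not> int q dvd i"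
      then have "coprime (int q) i" using q by (simp add: prime_imp_coprime)
      then obtain a b where "a * int q + b * i = 1"
        by (metis bezout_int coprime_iff_gcd_eq_1)
      then have "w = wpow (int q * a) \<otimes> wpow (i * b)"
        by (metis wpow_1 wpow_add mult.commute)
      also have "\<dots> = \<one>"
        using eq i M.int_pow_one[of a] M.int_pow_one[of b] by (simp add: wpow_mult)
      finally show False using w_neq_one by simp
    qed
  qed (rule dvd)
qed

lemma wpow_cong:
  assumes "[i = j] (mod int q)"
  shows "wpow i = wpow j"
proof -
  have "wpow (i - j) = \<one>" using assms by (simp add: wpow_eq_1_iff cong_iff_dvd_diff)
  then show ?thesis using wpow_add[of "i - j" j] by simp
qed

lemma conjg_wpow: "conjg (wpow i) = wpow (- i)"
proof -
  have nz: "conjg x \<noteq> \<zero>" if "x \<in> carrier K" "x \<noteq> \<zero>" for x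
    using that conjg_conjg[of x] by (metis conjg_el zero_eq_el add.inverse_neutral)
  have h: "group_hom (mult_of K) (mult_of K) conjg"
    by unfold_locales (auto simp: hom_def conjg_mult nz)
  have "w \<otimes> wpow (-1) = \<one>" using wpow_add[of 1 "-1"] by simp
  then have "w \<otimes> conjg w = w \<otimes> wpow (-1)" using norm_w by simp
  then have "conjg w = wpow (-1)" by (simp add: m_lcancel)
  then have "conjg (wpow i) = wpow (-1) [^]\<^bsub>mult_of K\<^esub> i"
    unfolding wpow_def[of i] by (simp add: group_hom.hom_int_pow[OF h])
  then show ?thesis by (simp flip: wpow_mult)
qed

text \<open>The elements of the Galois group of \<open>K\<close>, indexed so that composition is exclusive or, together with
  the exponents by which they act on powers of \<open>w\<close>.\<close>

definition gal :: "bool \<Rightarrow> 'a \<Rightarrow> 'a"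
  where "gal \<epsilon> x = (if \<epsilon> then conjg x else x)"

definition gal_sgn :: "bool \<Rightarrow> int"
  where "gal_sgn \<epsilon> = (if \<epsilon> then - 1 else 1)"

lemma gal_closed [simp]: "x \<in> carrier K \<Longrightarrow> gal \<epsilon> x \<in> carrier K"
  by (simp add: gal_def)

lemma gal_add: "x \<in> carrier K \<Longrightarrow> y \<in> carrier K \<Longrightarrow> gal \<epsilon> (x \<oplus> y) = gal \<epsilon> x \<oplus> gal \<epsilon> y"
  by (simp add: gal_def conjg_add)

lemma gal_mult: "x \<in> carrier K \<Longrightarrow> y \<in> carrier K \<Longrightarrow> gal \<epsilon> (x \<otimes> y) = gal \<epsilon> x \<otimes> gal \<epsilon> y"
  by (simp add: gal_def conjg_mult)

lemma gal_gal: "x \<in> carrier K \<Longrightarrow> gal \<epsilon> (gal \<epsilon>' x) = gal (\<epsilon> \<noteq> \<epsilon>') x"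
  by (auto simp: gal_def conjg_conjg)

lemma gal_zero [simp]: "gal \<epsilon> \<zero> = \<zero>" and gal_one [simp]: "gal \<epsilon> \<one> = \<one>"
  by (simp_all add: gal_def) (simp add: zero_eq_el)

lemma gal_minus: "x \<in> carrier K \<Longrightarrow> gal \<epsilon> (\<ominus> x) = \<ominus> gal \<epsilon> x"
  by (erule el_cases) (simp add: gal_def el_minus)

lemma gal_eq_0_iff: "x \<in> carrier K \<Longrightarrow> gal \<epsilon> x = \<zero> \<longleftrightarrow> x = \<zero>"
  using gal_gal[of x \<epsilon> \<epsilon>] gal_zero[of \<epsilon>] by (auto simp: gal_def)

text \<open>The congruence on \<open>i\<close> is exactly what makes the semilinear map \<open>x \<mapsto> u \<otimes> gal \<epsilon> x\<close> compatible
  with multiplication by \<open>i\<close> on the acting group.\<close>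

lemma gal_wpow:
  assumes "[i = gal_sgn \<epsilon>] (mod int q)"
  shows "gal \<epsilon> (wpow j) = wpow (i * j)"
proof -
  have "gal \<epsilon> (wpow j) = wpow (gal_sgn \<epsilon> * j)" by (simp add: gal_def gal_sgn_def conjg_wpow)
  also have "\<dots> = wpow (i * j)"
    using cong_mult[OF assms cong_refl[of j]] by (metis wpow_cong)
  finally show ?thesis .
qed

end

section \<open>The concrete model of \<open>G\<close>\<close>

context twisting_unit
begin

definition Q :: int where "Q = int (q\<^sup>2)"

text \<open>The semidirect product in which the generator \<open>(0, 1)\<close> of the second factor acts on \<open>K\<close> as
  multiplication by \<open>w\<close>. It corresponds to the inverse of \<open>a\<close>, because the relations of \<open>G\<close> prescribe
  \<open>a^(-1) b a\<close> rather than \<open>a b a^(-1)\<close>.\<close>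

definition H :: "('a \<times> int) monoid"
  where "H = \<lparr>carrier = carrier K \<times> {0..<Q},
    monoid.mult = (\<lambda>(x, i) (y, j). (x \<oplus> wpow i \<otimes> y, (i + j) mod Q)),
    one = (\<zero>, 0)\<rparr>"

lemma Q_gt_1: "Q > 1"
proof -
  have "1 ^ 2 < q ^ 2" using q by (intro power_strict_mono) (auto simp: prime_gt_Suc_0_nat prime_gt_1_nat)
  then show ?thesis by (simp add: Q_def del: of_nat_power)
qed

lemma Q_pos [simp]: "Q > 0" using Q_gt_1 by simp

lemma q_dvd_Q: "int q dvd Q" by (simp add: Q_def)

lemma cong_q_of_Q: "[i = j] (mod Q) \<Longrightarrow> [i = j] (mod int q)"
  using q_dvd_Q by (rule cong_dvd_modulus[rotated])

lemma wpow_mod [simp]: "wpow (i mod Q) = wpow i"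
  by (rule wpow_cong, rule cong_q_of_Q) simp

lemma carrier_H: "carrier H = carrier K \<times> {0..<Q}"
  and mult_H [simp]: "(x, i) \<otimes>\<^bsub>H\<^esub> (y, j) = (x \<oplus> wpow i \<otimes> y, (i + j) mod Q)"
  and one_H: "\<one>\<^bsub>H\<^esub> = (\<zero>, 0)"
  by (simp_all add: H_def)

lemma mem_H [simp]: "(x, i) \<in> carrier H \<longleftrightarrow> x \<in> carrier K \<and> 0 \<le> i \<and> i < Q"
  by (auto simp: carrier_H)

lemma group_H: "group H"
proof (rule groupI)
  fix z z' z'' assume "z \<in> carrier H" "z' \<in> carrier H" "z'' \<in> carrier H"
  then show "z \<otimes>\<^bsub>H\<^esub> z' \<otimes>\<^bsub>H\<^esub> z'' = z \<otimes>\<^bsub>H\<^esub> (z' \<otimes>\<^bsub>H\<^esub> z'')"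
    by (cases z; cases z'; cases z'')
      (simp add: wpow_add r_distr m_assoc a_assoc mod_add_left_eq mod_add_right_eq add.assoc)
next
  fix z assume z: "z \<in> carrier H"
  obtain x i where [simp]: "z = (x, i)" by (cases z)
  have "\<ominus> (wpow (- i) \<otimes> x) \<oplus> wpow (- i) \<otimes> x = \<zero>"
    using z by (simp add: l_neg)
  then show "\<exists>y\<in>carrier H. y \<otimes>\<^bsub>H\<^esub> z = \<one>\<^bsub>H\<^esub>"
    using z by (intro bexI[of _ "(\<ominus> (wpow (- i) \<otimes> x), (- i) mod Q)"])
      (auto simp: one_H mod_add_left_eq)
qed (auto simp: one_H)

sublocale H: group H by (rule group_H)

lemma finite_H: "finite (carrier H)"
  by (simp add: carrier_H finite_K)

section \<open>A four-parameter family of automorphisms\<close>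

text \<open>The automorphism \<open>(x, j) \<mapsto> (u \<otimes> gal \<epsilon> x, i j)\<close> of \<open>H\<close> followed by conjugation with \<open>(v, 0)\<close>, which
  adds \<open>v \<ominus> w^k v\<close> to the first component of \<open>(x, k)\<close>.\<close>

definition aff :: "'a \<Rightarrow> 'a \<Rightarrow> bool \<Rightarrow> int \<Rightarrow> 'a \<times> int \<Rightarrow> 'a \<times> int"
  where "aff v u \<epsilon> i =
    (\<lambda>z\<in>carrier H. (u \<otimes> gal \<epsilon> (fst z) \<oplus> (v \<ominus> wpow (i * snd z) \<otimes> v), i * snd z mod Q))"

lemma aff_apply:
  "x \<in> carrier K \<Longrightarrow> 0 \<le> j \<Longrightarrow> j < Q \<Longrightarrow>
    aff v u \<epsilon> i (x, j) = (u \<otimes> gal \<epsilon> x \<oplus> (v \<ominus> wpow (i * j) \<otimes> v), i * j mod Q)"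
  by (simp add: aff_def)

lemma compat_coprime:
  assumes "[i = gal_sgn \<epsilon>] (mod int q)"
  shows "\<not> int q dvd i"
proof
  assume "int q dvd i"
  then have "int q dvd gal_sgn \<epsilon>" using assms by (simp add: cong_dvd_iff)
  then show False using q by (auto simp: gal_sgn_def split: if_splits)
qed

lemma aff_hom:
  assumes v: "v \<in> carrier K" and u: "u \<in> carrier K"
    and i: "[i = gal_sgn \<epsilon>] (mod int q)"
  shows "aff v u \<epsilon> i \<in> hom H H"
proof (rule homI)
  fix z z' assume z: "z \<in> carrier H" "z' \<in> carrier H"
  obtain x j y k where [simp]: "z = (x, j)" "z' = (y, k)" by (cases z; cases z')
  have "u \<otimes> (x' \<oplus> ej \<otimes> y') \<oplus> (v \<ominus> ej \<otimes> ek \<otimes> v) =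
      u \<otimes> x' \<oplus> (v \<ominus> ej \<otimes> v) \<oplus> ej \<otimes> (u \<otimes> y' \<oplus> (v \<ominus> ek \<otimes> v))"
    if "x' \<in> carrier K" "y' \<in> carrier K" "ej \<in> carrier K" "ek \<in> carrier K" for x' y' ej ek
  proof -
    have cancel: "a \<oplus> (b \<oplus> (\<ominus> a \<oplus> c)) = b \<oplus> c"
      if "a \<in> carrier K" "b \<in> carrier K" "c \<in> carrier K" for a b c
      using that a_lcomm[of a b "\<ominus> a \<oplus> c"] by (simp add: r_neg2)
    show ?thesis
      using that u v by (simp add: minus_eq r_distr l_distr r_minus m_ac a_ac cancel)
  qed
  from this[of "gal \<epsilon> x" "gal \<epsilon> y" "wpow (i * j)" "wpow (i * k)"]
  show "aff v u \<epsilon> i (z \<otimes>\<^bsub>H\<^esub> z') = aff v u \<epsilon> i z \<otimes>\<^bsub>H\<^esub> aff v u \<epsilon> i z'"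
    using z u v
    by (simp add: aff_apply gal_add gal_mult gal_wpow[OF i])
      (simp add: wpow_add distrib_left mod_simps wpow_cong[OF cong_q_of_Q[of "i * ((j + k) mod Q)" "i * j + i * k"]]
        cong_def)
next
  fix z assume "z \<in> carrier H"
  then show "aff v u \<epsilon> i z \<in> carrier H"
    using u v by (cases z) (simp add: aff_apply)
qed

lemma aff_auto:
  assumes v: "v \<in> carrier K" and u: "u \<in> carrier K" "u \<noteq> \<zero>"
    and i: "[i = gal_sgn \<epsilon>] (mod int q)"
  shows "aff v u \<epsilon> i \<in> auto H"
proof -
  interpret h: group_hom H H "aff v u \<epsilon> i"
    by unfold_locales (rule aff_hom[OF v u(1) i])
  have "inj_on (aff v u \<epsilon> i) (carrier H)"
    unfolding h.inj_on_one_iff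
  proof (intro allI impI)
    fix z assume z: "z \<in> carrier H" and 1: "aff v u \<epsilon> i z = \<one>\<^bsub>H\<^esub>"
    obtain x j where zz [simp]: "z = (x, j)" by (cases z)
    have "Q dvd i * j" using 1 z by (simp add: aff_apply one_H mod_eq_0_iff_dvd)
    moreover have "coprime Q i"
      using compat_coprime[OF i] q by (simp add: Q_def prime_imp_coprime)
    ultimately have "Q dvd j" by (simp add: coprime_dvd_mult_right_iff)
    then have j: "j = 0" using z by (auto dest: zdvd_imp_le)
    have "u \<otimes> gal \<epsilon> x = \<zero>" using 1 z v u by (simp add: aff_apply one_H j minus_eq r_neg)
    then have "gal \<epsilon> x = \<zero>" using u z by (simp add: integral_iff)
    then have "x = \<zero>" using z by (simp add: gal_eq_0_iff)
    then show "z = \<one>\<^bsub>H\<^esub>" by (simp add: one_H j)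
  qed
  moreover have "aff v u \<epsilon> i ` carrier H = carrier H"
    using \<open>inj_on _ _\<close> finite_H h.hom_closed by (intro endo_inj_surj) auto
  ultimately show ?thesis
    using h.homh by (simp add: auto_def Bij_def bij_betw_def aff_def)
qed

lemma aff_comp:
  assumes v: "v \<in> carrier K" and u: "u \<in> carrier K" "u \<noteq> \<zero>" and i: "[i = gal_sgn \<epsilon>] (mod int q)"
    and v': "v' \<in> carrier K" and u': "u' \<in> carrier K" "u' \<noteq> \<zero>" and i': "[i' = gal_sgn \<epsilon>'] (mod int q)"
  shows "aff v u \<epsilon> i \<otimes>\<^bsub>AutoGroup H\<^esub> aff v' u' \<epsilon>' i' =
    aff (v \<oplus> u \<otimes> gal \<epsilon> v') (u \<otimes> gal \<epsilon> u') (\<epsilon> \<noteq> \<epsilon>') (i * i')"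
proof (rule auto_eqI)
  interpret A: group "AutoGroup H" by (rule H.AutoGroup)
  note a = aff_auto[OF v u i] and a' = aff_auto[OF v' u' i']
  show "aff v u \<epsilon> i \<otimes>\<^bsub>AutoGroup H\<^esub> aff v' u' \<epsilon>' i' \<in> auto H"
    using A.m_closed a a' by (simp add: carrier_AutoGroup)
  have ii: "[i * i' = gal_sgn (\<epsilon> \<noteq> \<epsilon>')] (mod int q)"
    using cong_mult[OF i i'] by (simp add: gal_sgn_def split: if_splits)
  have "u \<otimes> gal \<epsilon> u' \<noteq> \<zero>" using u u' by (simp add: integral_iff gal_eq_0_iff)
  then show "aff (v \<oplus> u \<otimes> gal \<epsilon> v') (u \<otimes> gal \<epsilon> u') (\<epsilon> \<noteq> \<epsilon>') (i * i') \<in> auto H"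
    using u u' v v' ii by (intro aff_auto) auto
  fix z assume z: "z \<in> carrier H"
  obtain x j where [simp]: "z = (x, j)" by (cases z)
  have "u \<otimes> (t \<otimes> x' \<oplus> (y \<ominus> ej \<otimes> y)) \<oplus> (v \<ominus> ej \<otimes> v) =
    u \<otimes> t \<otimes> x' \<oplus> (v \<oplus> u \<otimes> y \<ominus> ej \<otimes> (v \<oplus> u \<otimes> y))"
    if "x' \<in> carrier K" "y \<in> carrier K" "ej \<in> carrier K" "t \<in> carrier K" for x' y ej t
    using that u v by (simp add: minus_eq minus_add r_distr l_distr r_minus m_ac a_ac)
  from this[of "gal (\<epsilon> \<noteq> \<epsilon>') x" "gal \<epsilon> v'" "wpow (i * (i' * j))" "gal \<epsilon> u'"]
  show "(aff v u \<epsilon> i \<otimes>\<^bsub>AutoGroup H\<^esub> aff v' u' \<epsilon>' i') z =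
    aff (v \<oplus> u \<otimes> gal \<epsilon> v') (u \<otimes> gal \<epsilon> u') (\<epsilon> \<noteq> \<epsilon>') (i * i') z"
    using z u v u' v'
    by (simp add: AutoGroup_mult_apply[OF a a'] aff_apply gal_add gal_mult gal_gal minus_eq gal_minus gal_wpow[OF i])
      (simp add: mod_simps mult.assoc wpow_cong[OF cong_q_of_Q[of "i * (i' * j mod Q)" "i * (i' * j)"]] cong_def)
qed

lemma aff_cong: "[i = i'] (mod Q) \<Longrightarrow> aff v u \<epsilon> i = aff v u \<epsilon> i'"
proof -
  assume i: "[i = i'] (mod Q)"
  have "[i * j = i' * j] (mod Q)" for j using i by (rule cong_mult) simp
  then show ?thesis
    by (auto simp: aff_def fun_eq_iff restrict_def cong_def intro!: arg_cong[of _ _ "\<lambda>z. _ \<oplus> (v \<ominus> z \<otimes> v)"] wpow_cong[OF cong_q_of_Q])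
qed

lemma s_neq_conjg: "s \<noteq> conjg s"
proof
  assume "s = conjg s"
  then have "el 0 1 = el 0 (- 1)" by (metis s_eq_el conjg_el)
  then have "int p dvd 2" by (simp add: el_eq_iff cong_iff_dvd_diff)
  then have "p dvd 2" by presburger
  then have "p = 2" using p primes_dvd_imp_eq two_is_prime_nat by blast
  then show False using p_odd by simp
qed

lemma one_minus_nonzero: "x \<in> carrier K \<Longrightarrow> x \<noteq> \<one> \<Longrightarrow> \<one> \<ominus> x \<noteq> \<zero>"
  by (metis one_closed r_right_minus_eq)

text \<open>The values at \<open>(1, 0)\<close>, \<open>(s, 0)\<close> and \<open>(0, 1)\<close> determine \<open>u\<close>, then \<open>\<epsilon>\<close>, then \<open>i\<close> and
  \<open>v\<close>; the last because \<open>1 - w^i\<close> is invertible.\<close>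

lemma aff_eqD:
  assumes eq: "aff v u \<epsilon> i = aff v' u' \<epsilon>' i'"
    and v: "v \<in> carrier K" "v' \<in> carrier K" and u: "u \<in> carrier K" "u' \<in> carrier K" "u \<noteq> \<zero>"
    and i: "[i = gal_sgn \<epsilon>] (mod int q)" "[i' = gal_sgn \<epsilon>'] (mod int q)"
  shows "v = v' \<and> u = u' \<and> \<epsilon> = \<epsilon>' \<and> [i = i'] (mod Q)"
proof -
  have at: "aff v u \<epsilon> i (x, j) = aff v' u' \<epsilon>' i' (x, j)" for x j using eq by simp
  have uu: "u = u'" using at[of \<one> 0] u v by (simp add: aff_apply minus_eq r_neg)
  have "u \<otimes> gal \<epsilon> s = u \<otimes> gal \<epsilon>' s" using at[of s 0] u v by (simp add: aff_apply minus_eq r_neg uu)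
  then have "gal \<epsilon> s = gal \<epsilon>' s" using u by (simp add: m_lcancel)
  then have ee: "\<epsilon> = \<epsilon>'" using s_neq_conjg by (auto simp: gal_def split: if_splits)
  have 1: "v \<ominus> wpow i \<otimes> v = v' \<ominus> wpow i' \<otimes> v'" and ii: "[i = i'] (mod Q)"
    using at[of \<zero> 1] u v Q_gt_1 by (simp_all add: aff_apply cong_def)
  have ei: "wpow i = wpow i'" using ii by (intro wpow_cong cong_q_of_Q)
  have "wpow i \<noteq> \<one>" using compat_coprime[OF i(1)] by (simp add: wpow_eq_1_iff)
  moreover have "(\<one> \<ominus> wpow i) \<otimes> v = (\<one> \<ominus> wpow i) \<otimes> v'"
    using 1 v by (simp add: ei minus_eq l_distr l_minus)
  ultimately have "v = v'" using v one_minus_nonzero by (simp add: m_lcancel)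
  then show ?thesis using uu ee ii by simp
qed

end

section \<open>All automorphisms of the model\<close>

lemma mod_in_integer_mod_group: "M > 0 \<Longrightarrow> k mod int M \<in> carrier (integer_mod_group M)"
  by (simp add: carrier_integer_mod_group)

context twisting_unit
begin

lemma H_pow_fst: "x \<in> carrier K \<Longrightarrow> (x, 0) [^]\<^bsub>H\<^esub> k = (el (int k) 0 \<otimes> x, 0)" for k :: nat
proof (induction k)
  case 0
  then show ?case by (simp add: one_H flip: zero_eq_el)
next
  case (Suc k)
  have "el (int (Suc k)) 0 = el (int k) 0 \<oplus> \<one>"
    by (simp add: one_eq_el el_add add.commute)
  then show ?case using Suc by (simp add: l_distr)
qed

lemma H_pow_snd:
  "x \<in> carrier K \<Longrightarrow> 0 \<le> i \<Longrightarrow> i < Q \<Longrightarrow> snd ((x, i) [^]\<^bsub>H\<^esub> k) = int k * i mod Q" for k :: nat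
proof (induction k)
  case 0
  then show ?case by (simp add: one_H)
next
  case (Suc k)
  obtain y j where "(x, i) [^]\<^bsub>H\<^esub> k = (y, j)" by fastforce
  with Suc show ?case by (simp add: distrib_right mod_simps add.commute)
qed

text \<open>The parameters are read off from the images of the generators: \<open>u = f 1\<close> for the restriction \<open>f\<close> to
  \<open>K\<close>, the exponent \<open>i\<close> and the first component \<open>v'\<close> of the image of \<open>(0, 1)\<close>, and \<open>v = v' / (1 - w^i)\<close>. The
  member of the family with these parameters agrees with \<open>\<alpha>\<close> on generators.\<close>

lemma auto_H_exhaust:
  assumes \<alpha>: "\<alpha> \<in> auto H"
  obtains v u \<epsilon> i where "v \<in> carrier K" "u \<in> carrier K" "u \<noteq> \<zero>" "[i = gal_sgn \<epsilon>] (mod int q)"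
    "\<alpha> = aff v u \<epsilon> i"
proof -
  interpret \<alpha>: group_hom H H \<alpha>
    using \<alpha> by unfold_locales (simp add: auto_def)
  have inj: "inj_on \<alpha> (carrier H)"
    using \<alpha> by (simp add: auto_def Bij_def bij_betw_def)
  have zero: "el (int p) 0 = \<zero>" by (simp add: el_eq_0_iff)
  define f where "f x = fst (\<alpha> (x, 0))" for x
  have \<alpha>f: "\<alpha> (x, 0) = (f x, 0)" and fcl: "f x \<in> carrier K" if x: "x \<in> carrier K" for x
  proof -
    \<comment> \<open>elements of order dividing \<open>p\<close> have trivial second component, so \<open>K\<close> is characteristic\<close>
    obtain y j where yj: "\<alpha> (x, 0) = (y, j)" by fastforce
    have mem: "(y, j) \<in> carrier H" using x by (simp flip: yj)
    have "(y, j) [^]\<^bsub>H\<^esub> p = \<alpha> ((x, 0) [^]\<^bsub>H\<^esub> p)"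
      using x by (simp add: \<alpha>.hom_nat_pow yj)
    also have "\<dots> = \<one>\<^bsub>H\<^esub>"
      using x by (simp add: H_pow_fst zero flip: one_H)
    finally have "int p * j mod Q = 0"
      using H_pow_snd[of y j p] mem by (simp add: one_H)
    moreover have "coprime Q (int p)"
      using p q pq by (simp add: Q_def primes_coprime)
    ultimately have "Q dvd j"
      by (simp add: mod_eq_0_iff_dvd coprime_dvd_mult_right_iff)
    then have "j = 0" using mem by (auto dest: zdvd_imp_le)
    then show "\<alpha> (x, 0) = (f x, 0)" "f x \<in> carrier K"
      using mem yj by (simp_all add: f_def)
  qed
  have fadd: "f (x \<oplus> y) = f x \<oplus> f y" if "x \<in> carrier K" "y \<in> carrier K" for x y
    using \<alpha>.hom_mult[of "(x, 0)" "(y, 0)"] that by (simp add: \<alpha>f fcl)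
  have finj: "x = y" if "x \<in> carrier K" "y \<in> carrier K" "f x = f y" for x y
    using inj_onD[OF inj, of "(x, 0)" "(y, 0)"] that by (simp add: \<alpha>f)
  have f0: "f \<zero> = \<zero>" using \<alpha>.hom_one \<alpha>f[of \<zero>] by (simp add: one_H)
  obtain v' i where vi: "\<alpha> (\<zero>, 1) = (v', i)" by fastforce
  have mem: "(v', i) \<in> carrier H" using Q_gt_1 by (simp flip: vi)
  have semi: "f (w \<otimes> x) = wpow i \<otimes> f x" if x: "x \<in> carrier K" for x
  proof -
    \<comment> \<open>the relation that defines the action, transported by \<open>\<alpha>\<close>\<close>
    have "(\<zero>, 1) \<otimes>\<^bsub>H\<^esub> (x, 0) = (w \<otimes> x, 0) \<otimes>\<^bsub>H\<^esub> (\<zero>, 1)"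
      using x by simp
    then have "\<alpha> (\<zero>, 1) \<otimes>\<^bsub>H\<^esub> \<alpha> (x, 0) = \<alpha> (w \<otimes> x, 0) \<otimes>\<^bsub>H\<^esub> \<alpha> (\<zero>, 1)"
      using x Q_gt_1 \<alpha>.hom_mult[of "(\<zero>, 1)" "(x, 0)"] \<alpha>.hom_mult[of "(w \<otimes> x, 0)" "(\<zero>, 1)"] by simp
    then have "v' \<oplus> wpow i \<otimes> f x = v' \<oplus> f (w \<otimes> x)"
      using x mem fcl by (simp add: \<alpha>f vi a_comm)
    then show ?thesis using x mem fcl by simp
  qed
  have f1: "f \<one> \<noteq> \<zero>" using finj[of \<one> \<zero>] f0 by auto
  have "wpow i \<noteq> \<one>"
  proof
    assume "wpow i = \<one>"
    then have "f w = f \<one>" using semi[of \<one>] fcl by simp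
    then show False using finj[of w \<one>] w_neq_one by simp
  qed
  have "wpow i = w \<and> (\<forall>x\<in>carrier K. f x = f \<one> \<otimes> x) \<or>
        wpow i = conjg w \<and> (\<forall>x\<in>carrier K. f x = f \<one> \<otimes> conjg x)"
    unfolding w_el
    by (rule semilinear_cases[OF _ fadd n _ _ f1]) (use fcl semi in \<open>auto simp flip: w_el\<close>)
  then obtain \<epsilon> where \<epsilon>: "wpow i = gal \<epsilon> w" "\<And>x. x \<in> carrier K \<Longrightarrow> f x = f \<one> \<otimes> gal \<epsilon> x"
    by (metis gal_def)
  have "wpow i = wpow (gal_sgn \<epsilon>)"
    using \<epsilon>(1) conjg_wpow[of 1] by (simp add: gal_def gal_sgn_def split: if_splits)
  then have "wpow (i - gal_sgn \<epsilon>) = \<one>"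
    using wpow_add[of i "- gal_sgn \<epsilon>"] wpow_add[of "gal_sgn \<epsilon>" "- gal_sgn \<epsilon>"] by simp
  then have i: "[i = gal_sgn \<epsilon>] (mod int q)"
    by (simp add: wpow_eq_1_iff cong_iff_dvd_diff)
  have nz: "\<one> \<ominus> wpow i \<noteq> \<zero>" using \<open>wpow i \<noteq> \<one>\<close> by (simp add: one_minus_nonzero)
  define v where "v = inv (\<one> \<ominus> wpow i) \<otimes> v'"
  have U: "\<one> \<ominus> wpow i \<in> Units K" using nz by (simp add: field_Units)
  have v: "v \<in> carrier K" using mem U by (simp add: v_def)
  have "v' = (\<one> \<ominus> wpow i) \<otimes> v"
    using mem U by (simp add: v_def flip: m_assoc)
  then have v': "v' = v \<ominus> wpow i \<otimes> v" using v by (simp add: minus_eq l_distr l_minus)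
  define \<beta> where "\<beta> = aff v (f \<one>) \<epsilon> i"
  have \<beta>: "\<beta> \<in> auto H"
    unfolding \<beta>_def using v fcl f1 i by (intro aff_auto) auto
  interpret \<beta>: group_hom H H \<beta>
    using \<beta> by unfold_locales (simp add: auto_def)
  have b0: "\<beta> (x, 0) = \<alpha> (x, 0)" if "x \<in> carrier K" for x
    using that v fcl \<epsilon>(2)[of x] by (simp add: \<beta>_def aff_apply \<alpha>f minus_eq r_neg)
  have b1: "\<beta> (\<zero>, 1) = \<alpha> (\<zero>, 1)"
    using v v' fcl Q_gt_1 mem by (simp add: \<beta>_def aff_apply vi)
  have bj: "\<beta> (\<zero>, int j) = \<alpha> (\<zero>, int j)" if "int j < Q" for j
    using that
  proof (induction j)
    case 0
    show ?case using b0[of \<zero>] by simp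
  next
    case (Suc j)
    have "(\<zero>, int (Suc j)) = (\<zero>, int j) \<otimes>\<^bsub>H\<^esub> (\<zero>, 1)"
      using Suc.prems by (simp add: add.commute)
    moreover have "(\<zero>, int j) \<in> carrier H" "(\<zero>, 1) \<in> carrier H" using Suc.prems by auto
    ultimately show ?case using Suc b1 by (simp only: \<alpha>.hom_mult \<beta>.hom_mult)
  qed
  have "\<alpha> = \<beta>"
  proof (rule auto_eqI[OF \<alpha> \<beta>])
    fix z assume z: "z \<in> carrier H"
    obtain x j where zz: "z = (x, j)" by (cases z)
    then have prod: "z = (x, 0) \<otimes>\<^bsub>H\<^esub> (\<zero>, int (nat j))" using z by simp
    have mem: "(x, 0) \<in> carrier H" "(\<zero>, int (nat j)) \<in> carrier H" using z zz by auto
    have "\<beta> (\<zero>, int (nat j)) = \<alpha> (\<zero>, int (nat j))" using z zz by (intro bj) auto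
    moreover have "\<beta> (x, 0) = \<alpha> (x, 0)" using z zz by (intro b0) auto
    ultimately show "\<alpha> z = \<beta> z"
      using \<alpha>.hom_mult[OF mem] \<beta>.hom_mult[OF mem] by (simp only: prod)
  qed
  then show thesis using that[of v "f \<one>" i \<epsilon>] v fcl f1 i by (auto simp: \<beta>_def)
qed

end

locale primitive_root = twisting_unit +
  fixes \<sigma>
  assumes \<sigma>: "\<sigma> \<in> carrier (mult_of K)" and gen: "generate (mult_of K) {\<sigma>} = carrier (mult_of K)"
begin

text \<open>The discrete exponential with base \<open>\<sigma>\<close>; integer exponents match the carrier of \<open>integer_mod_group\<close>.\<close>

definition spow :: "int \<Rightarrow> 'a"
  where "spow k = \<sigma> [^]\<^bsub>mult_of K\<^esub> k"

lemma spow_M: "spow k \<in> carrier (mult_of K)"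
  unfolding spow_def using \<sigma> by (rule M.int_pow_closed)

lemma spow_closed [simp]: "spow k \<in> carrier K" and spow_nonzero [simp]: "spow k \<noteq> \<zero>"
  using spow_M[of k] by auto

lemma spow_0 [simp]: "spow 0 = \<one>" by (simp add: spow_def)

lemma spow_add: "spow (i + j) = spow i \<otimes> spow j"
  unfolding spow_def using M.int_pow_mult[OF \<sigma>, of i j] by simp

lemma spow_eq_iff: "spow i = spow j \<longleftrightarrow> [i = j] (mod int (p\<^sup>2 - 1))"
proof -
  have "M.ord \<sigma> = card (generate (mult_of K) {\<sigma>})"
    using \<sigma> by (rule M.generate_pow_card)
  also have "\<dots> = p\<^sup>2 - 1"
    unfolding gen using order_mult_of[OF finite_K] order_K by (simp add: order_def)
  finally show ?thesis
    unfolding spow_def using M.int_pow_eq[OF \<sigma>, of j i] by (auto simp: cong_iff_dvd_diff)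
qed

lemma spow_surj:
  assumes "x \<in> carrier K" "x \<noteq> \<zero>"
  obtains k where "k \<in> carrier (integer_mod_group (p\<^sup>2 - 1))" "x = spow k"
proof -
  have "x \<in> generate (mult_of K) {\<sigma>}" using assms gen by simp
  then obtain k :: int where "x = spow k"
    unfolding M.generate_pow[OF \<sigma>] spow_def by auto
  moreover have "1 ^ 2 < p ^ 2" using p by (intro power_strict_mono) (auto simp: prime_gt_1_nat prime_gt_Suc_0_nat)
  then have "p\<^sup>2 - 1 > 0" by simp
  ultimately show thesis
    by (intro that[of "k mod int (p\<^sup>2 - 1)"] mod_in_integer_mod_group) (simp_all only: spow_eq_iff cong_mod_right cong_refl)
qed

end

section \<open>The presented group is the model\<close>

context twisting_unit
begin

definition gen_image :: "gen \<Rightarrow> 'a \<times> int"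
  where "gen_image x = (case x of Gen_a \<Rightarrow> inv\<^bsub>H\<^esub> (\<zero>, 1) | Gen_b \<Rightarrow> (s, 0) | Gen_c \<Rightarrow> (\<one>, 0))"

lemma t_closed: "(\<zero>, 1) \<in> carrier H" using Q_gt_1 by simp

lemma gen_image_closed: "gen_image x \<in> carrier H"
  by (cases x) (simp_all only: gen_image_def gen.case H.inv_closed t_closed, simp_all)

lemma H_int_pow_fst: "x \<in> carrier K \<Longrightarrow> (x, 0) [^]\<^bsub>H\<^esub> k = (el k 0 \<otimes> x, 0)" for k :: int
proof (cases k)
  fix j assume x: "x \<in> carrier K" and k: "k = int j"
  then show ?thesis by (simp add: int_pow_int H_pow_fst)
next
  fix j assume x: "x \<in> carrier K" and k: "k = - int (Suc j)"
  have "(x, 0) [^]\<^bsub>H\<^esub> k = inv\<^bsub>H\<^esub> ((x, 0) [^]\<^bsub>H\<^esub> Suc j)"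
    unfolding k using x by (intro H.int_pow_neg_int) simp
  also have "\<dots> = (el k 0 \<otimes> x, 0)"
  proof (rule H.inv_equality)
    have "el k 0 \<otimes> x \<oplus> el (int (Suc j)) 0 \<otimes> x = el (k + int (Suc j)) 0 \<otimes> x"
      using x by (simp flip: l_distr el_add[of _ 0 _ 0, simplified])
    also have "\<dots> = \<zero>" using x by (simp add: k flip: zero_eq_el)
    finally show "(el k 0 \<otimes> x, 0) \<otimes>\<^bsub>H\<^esub> (x, 0) [^]\<^bsub>H\<^esub> Suc j = \<one>\<^bsub>H\<^esub>"
      using x by (simp only: H_pow_fst) (simp add: one_H)
  qed (use x in auto)
  finally show ?thesis .
qed

lemma H_int_pow_t: "(\<zero>, 1) [^]\<^bsub>H\<^esub> k = (\<zero>, k mod Q)" for k :: int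
proof -
  have nat: "(\<zero>, 1) [^]\<^bsub>H\<^esub> j = (\<zero>, int j mod Q)" for j :: nat
    by (induction j) (simp_all add: one_H mod_simps add.commute)
  show ?thesis
  proof (cases k)
    fix j assume "k = int j"
    then show ?thesis by (simp add: int_pow_int nat)
  next
    fix j assume k: "k = - int (Suc j)"
    have "(\<zero>, 1) [^]\<^bsub>H\<^esub> k = inv\<^bsub>H\<^esub> ((\<zero>, 1) [^]\<^bsub>H\<^esub> Suc j)"
      unfolding k using t_closed by (intro H.int_pow_neg_int)
    also have "\<dots> = (\<zero>, k mod Q)"
      unfolding nat by (rule H.inv_equality) (auto simp: one_H mod_simps k)
    finally show ?thesis .
  qed
qed

lemma H_relations:
  "\<forall>(l, r) \<in> G_relations p q D m n. word_eval H gen_image l = word_eval H gen_image r"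
proof -
  define t where "t = (\<zero>, 1 :: int)"
  have t: "t \<in> carrier H" using t_closed by (simp add: t_def)
  have "t [^]\<^bsub>H\<^esub> (q\<^sup>2) = \<one>\<^bsub>H\<^esub>"
    using H_int_pow_t[of "int (q\<^sup>2)"] by (simp only: int_pow_int t_def) (simp add: one_H Q_def)
  then have a: "inv\<^bsub>H\<^esub> t [^]\<^bsub>H\<^esub> (q\<^sup>2) = \<one>\<^bsub>H\<^esub>"
    using t by (simp only: H.nat_pow_inv) simp
  have zero: "el (int p) 0 = \<zero>" by (simp add: el_eq_0_iff)
  have b: "(x, 0) [^]\<^bsub>H\<^esub> p = \<one>\<^bsub>H\<^esub>" if "x \<in> carrier K" for x
    using that by (simp add: H_pow_fst zero one_H)
  have conj: "t \<otimes>\<^bsub>H\<^esub> (x, 0) \<otimes>\<^bsub>H\<^esub> inv\<^bsub>H\<^esub> t = (w \<otimes> x, 0)" if "x \<in> carrier K" for x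
  proof -
    have "t \<otimes>\<^bsub>H\<^esub> (x, 0) = (w \<otimes> x, 0) \<otimes>\<^bsub>H\<^esub> t"
      using that by (simp add: t_def)
    then show ?thesis using that t by (simp add: H.m_assoc)
  qed
  have ws: "w \<otimes> s = el (n * D) m"
    using el_mult[of m n 0 1] s_eq_el by (simp add: w_el)
  have el1: "el a 0 \<otimes> s \<oplus> el b 0 = el b a" for a b
    using a_comm by (simp add: el_def)
  show ?thesis
    unfolding H.word_eval_G_relations[of gen_image, OF gen_image_closed]
    by (simp add: gen_image_def a b conj H.inv_inv t H_int_pow_fst ws el1 a_comm flip: t_def)
      (simp add: w_el)
qed

lemma gen_image_eval:
  "word_eval H gen_image (gen_pow Gen_b i @ gen_pow Gen_c j @ gen_pow Gen_a k) = (el j i, (- k) mod Q)"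
proof -
  have "inv\<^bsub>H\<^esub> (\<zero>, 1) [^]\<^bsub>H\<^esub> k = (\<zero>, (- k) mod Q)"
    using H.int_pow_inv[OF t_closed, of k] H.int_pow_neg[OF t_closed, of k] by (simp add: H_int_pow_t)
  moreover have "el i 0 \<otimes> s \<oplus> el j 0 = el j i"
    using a_comm by (simp add: el_def)
  ultimately show ?thesis
    by (simp add: H.word_eval_append[of gen_image, OF gen_image_closed] H.word_eval_gen_pow[of gen_image, OF gen_image_closed])
      (simp add: gen_image_def H_int_pow_fst)
qed

text \<open>A word that is trivial in \<open>H\<close> equals some \<open>b^i c^j a^k\<close> in the presented group. Its value \<open>(el j i, - k)\<close> in
  \<open>H\<close> is trivial, so the three powers are already trivial in the presented group.\<close>

lemma G_group_iso_H: "G_group p q D m n \<cong> H"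
  unfolding G_group_def
proof (rule presented_group_iso[of H gen_image])
  let ?R = "G_relations p q D m n"
  let ?P = "presented_group ?R"
  interpret P: group ?P by (rule group_presented_group)
  define c where "c = (\<lambda>x. pres_rel ?R `` {[(x, True)]})"
  have c: "c x \<in> carrier ?P" for x
    unfolding c_def presented_group_carrier by (rule rangeI)
  have eval: "word_eval ?P c w = pres_rel ?R `` {w}" for w
    unfolding c_def by (rule word_eval_presented_group)
  have "pres_eq ?R l r" if "(l, r) \<in> ?R" for l r
    using pres_eq.rel[OF that, of "[]" "[]"] by simp
  then have "\<forall>(l, r) \<in> ?R. word_eval ?P c l = word_eval ?P c r"
    unfolding eval by (auto simp only: pres_class_eq_iff)
  note rels = this[unfolded P.word_eval_G_relations[of c, OF c]]
  show rel: "word_eval H gen_image l = word_eval H gen_image r" if "(l, r) \<in> ?R" for l r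
    using that H_relations by blast
  fix w assume w: "word_eval H gen_image w = \<one>\<^bsub>H\<^esub>"
  have "\<exists>(i :: int) (j :: int) (k :: int). word_eval ?P c w =
      c Gen_b [^]\<^bsub>?P\<^esub> i \<otimes>\<^bsub>?P\<^esub> c Gen_c [^]\<^bsub>?P\<^esub> j \<otimes>\<^bsub>?P\<^esub> c Gen_a [^]\<^bsub>?P\<^esub> k"
    by (rule P.word_eval_normal_form[where N = "q\<^sup>2" and m = m and n = n and D = D])
      (use rels c q in \<open>auto simp: prime_gt_0_nat\<close>)
  then obtain i j k :: int where ijk: "word_eval ?P c w =
      c Gen_b [^]\<^bsub>?P\<^esub> i \<otimes>\<^bsub>?P\<^esub> c Gen_c [^]\<^bsub>?P\<^esub> j \<otimes>\<^bsub>?P\<^esub> c Gen_a [^]\<^bsub>?P\<^esub> k"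
    by blast
  let ?w = "gen_pow Gen_b i @ gen_pow Gen_c j @ gen_pow Gen_a k"
  have "word_eval ?P c w = word_eval ?P c ?w"
    using c by (simp add: ijk P.word_eval_append[of c, OF c] P.word_eval_gen_pow[of c, OF c] P.m_assoc)
  then have "pres_eq ?R w ?w" by (simp only: eval pres_class_eq_iff)
  then have "word_eval H gen_image w = word_eval H gen_image ?w"
    using H.word_eval_pres_eq[of gen_image ?R, OF gen_image_closed rel] by blast
  then have "(el j i, (- k) mod Q) = (\<zero>, 0)"
    using w by (simp only: gen_image_eval one_H)
  then have dvd: "int p dvd i" "int p dvd j" "int (q\<^sup>2) dvd k"
    by (auto simp: el_eq_0_iff mod_eq_0_iff_dvd Q_def simp del: of_nat_power)
  have pow: "x [^]\<^bsub>?P\<^esub> l = \<one>\<^bsub>?P\<^esub>"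
    if "x \<in> carrier ?P" "x [^]\<^bsub>?P\<^esub> N = \<one>\<^bsub>?P\<^esub>" "int N dvd l" for x and N :: nat and l :: int
  proof -
    from that(3) obtain l' where "l = int N * l'" ..
    then show ?thesis using that P.int_pow_pow[of x "int N" l'] by (simp add: int_pow_int)
  qed
  show "pres_rel ?R `` {w} = \<one>\<^bsub>?P\<^esub>"
    unfolding eval[symmetric] ijk using pow[OF c _ dvd(1)] pow[OF c _ dvd(2)] pow[OF c _ dvd(3)] rels
    by simp
next
  show "carrier H \<subseteq> range (word_eval H gen_image)"
  proof
    fix z assume z: "z \<in> carrier H"
    obtain x l where zz: "z = (x, l)" by (cases z)
    obtain j i where "x = el j i" using z zz by (auto elim: el_cases)
    then have "z = word_eval H gen_image (gen_pow Gen_b i @ gen_pow Gen_c j @ gen_pow Gen_a (- l))"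
      unfolding gen_image_eval using z zz by simp
    then show "z \<in> range (word_eval H gen_image)" by blast
  qed
qed (rule group_H gen_image_closed)+

end

section \<open>The automorphism group as an iterated semidirect product\<close>

context primitive_root
begin

text \<open>The factors are embedded by \<open>h\<close> (conjugations by elements of \<open>K\<close>), \<open>f\<close> (units of \<open>K\<close> and residues
  \<open>1 + q l\<close>) and \<open>g\<close> (the field automorphism with exponent \<open>-1\<close>). Their product has the parameters
  \<open>(el a b, \<sigma>^k, y = 1, \<plusminus>(1 + q l))\<close>, which is a bijection onto all admissible parameters.\<close>

lemma AutoGroup_H_iso:
  "\<exists>\<phi> \<psi>.
    \<phi> \<in> hom (integer_mod_group 2)
          (AutoGroup (integer_mod_group (p^2 - 1) \<times>\<times> integer_mod_group q)) \<and>
    \<psi> \<in> hom (semidirect_product (integer_mod_group (p^2 - 1) \<times>\<times> integer_mod_group q)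
                (integer_mod_group 2) \<phi>)
          (AutoGroup (integer_mod_group p \<times>\<times> integer_mod_group p)) \<and>
    AutoGroup H \<cong>
      semidirect_product (integer_mod_group p \<times>\<times> integer_mod_group p)
        (semidirect_product (integer_mod_group (p^2 - 1) \<times>\<times> integer_mod_group q)
          (integer_mod_group 2) \<phi>) \<psi>"
proof -
  define N where "N = p\<^sup>2 - 1"
  let ?L = "integer_mod_group N \<times>\<times> integer_mod_group q"
  let ?V = "integer_mod_group p \<times>\<times> integer_mod_group p"
  let ?A = "AutoGroup H"
  interpret A: group ?A by (rule H.AutoGroup)
  have L: "group ?L" and V: "group ?V" by (simp_all add: DirProd_group)
  have p0: "p > 0" and q0: "q > 0" using p q by (simp_all add: prime_gt_0_nat)
  define f :: "int \<times> int \<Rightarrow> _" where "f = (\<lambda>(k, l). aff \<zero> (spow k) False (1 + int q * l))"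
  define g :: "int \<Rightarrow> _" where "g = (\<lambda>y. aff \<zero> \<one> (y = 1) (gal_sgn (y = 1)))"
  define h :: "int \<times> int \<Rightarrow> _" where "h = (\<lambda>(a, b). aff (el a b) \<one> False 1)"
  have sgT: "[1 + int q * l = gal_sgn False] (mod int q)" for l by (simp add: gal_sgn_def cong_iff_dvd_diff)
  have sgF: "[1 = gal_sgn False] (mod int q)" by (simp add: gal_sgn_def)
  have sgm: "[(1 + int q * l) * gal_sgn \<epsilon> = gal_sgn \<epsilon>] (mod int q)" for l \<epsilon>
    using cong_mult[OF sgT[of l] cong_refl[of "gal_sgn \<epsilon>"]] by (simp add: gal_sgn_def)
  have Q_prod: "Q = int q * int q" by (simp add: Q_def monoid_mult_class.power2_eq_square)
  have mod_Q: "[int q * (l mod int q) = int q * l] (mod Q)" for l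
    by (simp only: cong_def Q_prod mult_mod_right mod_mod_trivial)
  have galF [simp]: "gal False x = x" for x by (simp add: gal_def)
  have f: "f \<in> hom ?L ?A"
  proof (rule homI)
    fix x x' assume x: "x \<in> carrier ?L" "x' \<in> carrier ?L"
    obtain k l k' l' where [simp]: "x = (k, l)" "x' = (k', l')" by (cases x; cases x')
    have "f x \<otimes>\<^bsub>?A\<^esub> f x' = aff \<zero> (spow k \<otimes> spow k') False ((1 + int q * l) * (1 + int q * l'))"
      by (simp add: f_def aff_comp[OF _ _ _ sgT _ _ _ sgT])
    also have "spow k \<otimes> spow k' = spow ((k + k') mod int N)"
      by (simp add: spow_eq_iff N_def flip: spow_add)
    also have "[1 + int q * ((l + l') mod int q) = (1 + int q * l) * (1 + int q * l')] (mod Q)"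
    proof -
      have "[1 + int q * ((l + l') mod int q) = 1 + int q * (l + l') + Q * (l * l')] (mod Q)"
        using cong_add[OF cong_add[OF cong_refl[of 1] mod_Q[of "l + l'"]], of 0 "Q * (l * l')"]
        by (simp add: cong_iff_dvd_diff)
      then show ?thesis
        by (simp add: Q_def monoid_mult_class.power2_eq_square algebra_simps)
    qed
    then have "aff \<zero> (spow ((k + k') mod int N)) False ((1 + int q * l) * (1 + int q * l')) = f (x \<otimes>\<^bsub>?L\<^esub> x')"
      by (simp add: f_def aff_cong cong_sym)
    finally show "f (x \<otimes>\<^bsub>?L\<^esub> x') = f x \<otimes>\<^bsub>?A\<^esub> f x'" by simp
  qed (auto simp: f_def carrier_AutoGroup intro!: aff_auto sgT)
  have g: "g \<in> hom (integer_mod_group 2) ?A"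
  proof (rule homI)
    fix y y' assume y: "y \<in> carrier (integer_mod_group 2)" "y' \<in> carrier (integer_mod_group 2)"
    then have "y = 0 \<or> y = 1" "y' = 0 \<or> y' = 1" by (auto simp: carrier_integer_mod_group)
    moreover have "g y \<otimes>\<^bsub>?A\<^esub> g y' = aff \<zero> \<one> ((y = 1) \<noteq> (y' = 1)) (gal_sgn (y = 1) * gal_sgn (y' = 1))"
      unfolding g_def by (subst aff_comp) (auto simp del: galF)
    ultimately show "g (y \<otimes>\<^bsub>integer_mod_group 2\<^esub> y') = g y \<otimes>\<^bsub>?A\<^esub> g y'"
      by (auto simp: g_def gal_sgn_def)
  qed (auto simp: g_def carrier_AutoGroup intro!: aff_auto)
  have h: "h \<in> hom ?V ?A"
  proof (rule homI)
    fix x x' assume x: "x \<in> carrier ?V" "x' \<in> carrier ?V"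
    obtain a b a' b' where [simp]: "x = (a, b)" "x' = (a', b')" by (cases x; cases x')
    have "h x \<otimes>\<^bsub>?A\<^esub> h x' = aff (el a b \<oplus> el a' b') \<one> False 1"
      by (simp add: h_def aff_comp[OF _ _ _ sgF _ _ _ sgF])
    also have "el a b \<oplus> el a' b' = el ((a + a') mod int p) ((b + b') mod int p)"
      by (simp add: el_add el_eq_iff)
    finally show "h (x \<otimes>\<^bsub>?V\<^esub> x') = h x \<otimes>\<^bsub>?A\<^esub> h x'" by (simp add: h_def)
  qed (auto simp: h_def carrier_AutoGroup intro!: aff_auto sgF)
  \<comment> \<open>the parameters of the products of the embedded factors\<close>
  have fg: "f x \<otimes>\<^bsub>?A\<^esub> g y = aff \<zero> (spow (fst x)) (y = 1) ((1 + int q * snd x) * gal_sgn (y = 1))" for x y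
    unfolding f_def g_def case_prod_beta by (subst aff_comp[OF _ _ _ sgT]) auto
  have hfg: "h v \<otimes>\<^bsub>?A\<^esub> aff \<zero> u \<epsilon> i = aff (el (fst v) (snd v)) u \<epsilon> i"
    if "u \<in> carrier K" "u \<noteq> \<zero>" "[i = gal_sgn \<epsilon>] (mod int q)" for v u \<epsilon> i
    unfolding h_def case_prod_beta using that by (subst aff_comp[OF _ _ _ sgF]) auto
  have injV: "v = v'"
    if "v \<in> carrier ?V" "v' \<in> carrier ?V" "el (fst v) (snd v) = el (fst v') (snd v')" for v v'
    using that p0 by (cases v; cases v') (auto simp: el_eq_iff cong_def carrier_integer_mod_group)
  have N0: "N > 0"
  proof -
    have "1 ^ 2 < p ^ 2" using p by (intro power_strict_mono) (auto simp: prime_gt_Suc_0_nat prime_gt_1_nat)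
    then show ?thesis by (simp add: N_def)
  qed
  have injL: "x = x' \<and> y = y'"
    if x: "x \<in> carrier ?L" "x' \<in> carrier ?L"
      and y: "y \<in> carrier (integer_mod_group 2)" "y' \<in> carrier (integer_mod_group 2)"
      and r: "spow (fst x) = spow (fst x')" and \<epsilon>: "(y = 1) = (y' = 1)"
      and i: "[(1 + int q * snd x) * gal_sgn (y = 1) = (1 + int q * snd x') * gal_sgn (y' = 1)] (mod Q)"
    for x x' y y'
  proof -
    have "[fst x = fst x'] (mod int N)" using r by (simp only: spow_eq_iff N_def)
    then have "fst x = fst x'" using x N0 by (auto simp: cong_def carrier_integer_mod_group)
    have "Q dvd (int q * (snd x - snd x')) * gal_sgn (y = 1)"
      using i by (simp add: cong_iff_dvd_diff algebra_simps \<epsilon>)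
    then have "int q * int q dvd int q * (snd x - snd x')"
      by (simp add: Q_def monoid_mult_class.power2_eq_square gal_sgn_def dvd_diff_commute split: if_splits)
    then have "[snd x = snd x'] (mod int q)" using q0 by (simp add: cong_iff_dvd_diff)
    then have "snd x = snd x'" using x q0 by (auto simp: cong_def carrier_integer_mod_group)
    moreover have "y = y'" using y \<epsilon> by (auto simp: carrier_integer_mod_group)
    ultimately show ?thesis using \<open>fst x = fst x'\<close> by (simp add: prod_eq_iff)
  qed
  have spow_surj': "\<exists>k. k \<in> carrier (integer_mod_group N) \<and> x = spow k" if "x \<in> carrier K" "x \<noteq> \<zero>" for x
    using spow_surj[OF that] unfolding N_def by blast
  obtain \<phi> where \<phi>: "\<phi> \<in> hom (integer_mod_group 2) (AutoGroup ?L)"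
    and F: "(\<lambda>(x, y). f x \<otimes>\<^bsub>?A\<^esub> g y) \<in> hom (semidirect_product ?L (integer_mod_group 2) \<phi>) ?A"
  proof (rule A.semidirect_product_hom_exists[OF L _ f g])
    show "inj_on (\<lambda>(x, y). f x \<otimes>\<^bsub>?A\<^esub> g y) (carrier ?L \<times> carrier (integer_mod_group 2))"
    proof (rule inj_onI)
      fix a a' assume a: "a \<in> carrier ?L \<times> carrier (integer_mod_group 2)"
        "a' \<in> carrier ?L \<times> carrier (integer_mod_group 2)"
        and eq: "(\<lambda>(x, y). f x \<otimes>\<^bsub>?A\<^esub> g y) a = (\<lambda>(x, y). f x \<otimes>\<^bsub>?A\<^esub> g y) a'"
      obtain x y x' y' where [simp]: "a = (x, y)" "a' = (x', y')" by (metis prod.exhaust)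
      have eq': "f x \<otimes>\<^bsub>?A\<^esub> g y = f x' \<otimes>\<^bsub>?A\<^esub> g y'" using eq by simp
      have *: "x \<in> carrier ?L" "x' \<in> carrier ?L"
        "y \<in> carrier (integer_mod_group 2)" "y' \<in> carrier (integer_mod_group 2)"
        using a by auto
      have "\<zero> = \<zero> \<and> spow (fst x) = spow (fst x') \<and> (y = 1) = (y' = 1) \<and>
          [(1 + int q * snd x) * gal_sgn (y = 1) = (1 + int q * snd x') * gal_sgn (y' = 1)] (mod Q)"
        by (rule aff_eqD[OF eq'[unfolded fg]]) (auto simp: sgm)
      then have "x = x' \<and> y = y'" using injL[OF *] by blast
      then show "a = a'" by simp
    qed
    fix x y assume x: "x \<in> carrier ?L" and y: "y \<in> carrier (integer_mod_group 2)"
    \<comment> \<open>the involution commutes with the residues \<open>1 + q l\<close> and conjugates units by the field automorphism\<close>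
    obtain k where k: "k \<in> carrier (integer_mod_group N)" "gal (y = 1) (spow (fst x)) = spow k"
      using spow_surj'[of "gal (y = 1) (spow (fst x))"] by (auto simp: gal_eq_0_iff)
    have "g y \<otimes>\<^bsub>?A\<^esub> f x = f (k, snd x) \<otimes>\<^bsub>?A\<^esub> g y"
      unfolding fg unfolding f_def g_def case_prod_beta
      by (subst aff_comp[OF _ _ _ _ _ _ _ sgT]) (auto simp: k mult.commute)
    then show "\<exists>x'\<in>carrier ?L. g y \<otimes>\<^bsub>?A\<^esub> f x = f x' \<otimes>\<^bsub>?A\<^esub> g y"
      using x k by (intro bexI[of _ "(k, snd x)"]) auto
  qed simp
  let ?Y = "semidirect_product ?L (integer_mod_group 2) \<phi>"
  let ?F = "\<lambda>(x, y). f x \<otimes>\<^bsub>?A\<^esub> g y"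
  have Y: "group ?Y" using L \<phi> by (intro group_semidirect_product) auto
  have F_eq: "?F z = aff \<zero> (spow (fst (fst z))) (snd z = 1) ((1 + int q * snd (fst z)) * gal_sgn (snd z = 1))" for z
    by (simp add: fg case_prod_beta)
  have hF: "h v \<otimes>\<^bsub>?A\<^esub> ?F z =
      aff (el (fst v) (snd v)) (spow (fst (fst z))) (snd z = 1) ((1 + int q * snd (fst z)) * gal_sgn (snd z = 1))" for v z
    unfolding F_eq by (rule hfg) (auto simp: sgm)
  have inj: "inj_on (\<lambda>(v, z). h v \<otimes>\<^bsub>?A\<^esub> ?F z) (carrier ?V \<times> carrier ?Y)"
  proof (rule inj_onI)
    fix a a' assume a: "a \<in> carrier ?V \<times> carrier ?Y" "a' \<in> carrier ?V \<times> carrier ?Y"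
      and eq: "(\<lambda>(v, z). h v \<otimes>\<^bsub>?A\<^esub> ?F z) a = (\<lambda>(v, z). h v \<otimes>\<^bsub>?A\<^esub> ?F z) a'"
    obtain v x y v' x' y' where [simp]: "a = (v, (x, y))" "a' = (v', (x', y'))"
      by (metis prod.exhaust)
    have eq': "h v \<otimes>\<^bsub>?A\<^esub> ?F (x, y) = h v' \<otimes>\<^bsub>?A\<^esub> ?F (x', y')" using eq by simp
    have *: "v \<in> carrier ?V" "v' \<in> carrier ?V" "x \<in> carrier ?L" "x' \<in> carrier ?L"
      "y \<in> carrier (integer_mod_group 2)" "y' \<in> carrier (integer_mod_group 2)"
      using a by (auto simp: semidirect_product_def)
    have "el (fst v) (snd v) = el (fst v') (snd v') \<and> spow (fst x) = spow (fst x') \<and> (y = 1) = (y' = 1) \<and>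
        [(1 + int q * snd x) * gal_sgn (y = 1) = (1 + int q * snd x') * gal_sgn (y' = 1)] (mod Q)"
      by (rule aff_eqD[OF eq'[unfolded hF fst_conv snd_conv]]) (auto simp: sgm)
    then have "v = v' \<and> x = x' \<and> y = y'"
      using injV[OF *(1,2)] injL[OF *(3-6)] by blast
    then show "a = a'" by simp
  qed
  obtain \<psi> where \<psi>: "\<psi> \<in> hom ?Y (AutoGroup ?V)"
    and E: "(\<lambda>(v, z). h v \<otimes>\<^bsub>?A\<^esub> ?F z) \<in> hom (semidirect_product ?V ?Y \<psi>) ?A"
  proof (rule A.semidirect_product_hom_exists[OF V Y h F inj])
    fix v z assume v: "v \<in> carrier ?V" and z: "z \<in> carrier ?Y"
    \<comment> \<open>a semilinear map sends the conjugation by \<open>x\<close> to the conjugation by its value at \<open>x\<close>\<close>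
    let ?u = "spow (fst (fst z))" and ?\<epsilon> = "snd z = 1"
    obtain v' where v': "v' \<in> carrier ?V" "?u \<otimes> gal ?\<epsilon> (el (fst v) (snd v)) = el (fst v') (snd v')"
    proof -
      obtain a b where "?u \<otimes> gal ?\<epsilon> (el (fst v) (snd v)) = el a b"
        by (rule el_cases[of "?u \<otimes> gal ?\<epsilon> (el (fst v) (snd v))"]) auto
      then show thesis
        using p0 by (intro that[of "(a mod int p, b mod int p)"])
          (auto simp: el_eq_iff mod_in_integer_mod_group)
    qed
    have "?F z \<otimes>\<^bsub>?A\<^esub> h v = h v' \<otimes>\<^bsub>?A\<^esub> ?F z"
      unfolding hF unfolding F_eq h_def case_prod_beta
      by (subst aff_comp[OF _ _ _ sgm _ _ _ sgF]) (auto simp: v')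
    then show "\<exists>v'\<in>carrier ?V. ?F z \<otimes>\<^bsub>?A\<^esub> h v = h v' \<otimes>\<^bsub>?A\<^esub> ?F z"
      using v'(1) by blast
  qed
  let ?S = "semidirect_product ?V ?Y \<psi>"
  let ?E = "\<lambda>(v, z). h v \<otimes>\<^bsub>?A\<^esub> ?F z"
  have carS: "carrier ?S = carrier ?V \<times> (carrier ?L \<times> carrier (integer_mod_group 2))"
    by (simp add: semidirect_product_def)
  have "carrier ?A \<subseteq> ?E ` carrier ?S"
  proof
    fix \<alpha> assume "\<alpha> \<in> carrier ?A"
    then obtain v u \<epsilon> i where vu: "v \<in> carrier K" "u \<in> carrier K" "u \<noteq> \<zero>" "[i = gal_sgn \<epsilon>] (mod int q)"
      "\<alpha> = aff v u \<epsilon> i"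
      by (auto simp: carrier_AutoGroup elim: auto_H_exhaust)
    obtain a b where ab: "v = el a b" using vu(1) by (rule el_cases)
    obtain k where k: "k \<in> carrier (integer_mod_group N)" "u = spow k" using spow_surj' vu by blast
    \<comment> \<open>\<open>i\<close> is \<open>\<plusminus>1\<close> modulo \<open>q\<close>, so it is \<open>\<plusminus>(1 + q l)\<close> with \<open>l\<close> determined modulo \<open>q\<close>\<close>
    have "gal_sgn \<epsilon> * gal_sgn \<epsilon> = 1" by (simp add: gal_sgn_def)
    then have "int q dvd i * gal_sgn \<epsilon> - 1"
      using cong_mult[OF vu(4) cong_refl[of "gal_sgn \<epsilon>"]] by (simp only: cong_iff_dvd_diff)
    then obtain l where "i * gal_sgn \<epsilon> - 1 = int q * l" ..
    then have i: "i = (1 + int q * l) * gal_sgn \<epsilon>"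
      by (auto simp: gal_sgn_def algebra_simps split: if_splits)
    define z where "z = ((k, l mod int q), if \<epsilon> then 1 else 0 :: int)"
    define v' where "v' = (a mod int p, b mod int p)"
    have mem_S: "(v', z) \<in> carrier ?S"
      unfolding carS using k p0 q0 by (auto simp: z_def v'_def mod_in_integer_mod_group carrier_integer_mod_group)
    have E_eq: "?E (v', z) = \<alpha>"
    proof -
      have i_cong: "[(1 + int q * (l mod int q)) * gal_sgn \<epsilon> = i] (mod Q)"
        unfolding i by (intro cong_mult cong_add cong_refl mod_Q)
      have z: "fst z = (k, l mod int q)" "(snd z = 1) = \<epsilon>" by (simp_all add: z_def)
      have v: "el (fst v') (snd v') = v" by (simp add: v'_def ab el_eq_iff)
      have "?E (v', z) = h v' \<otimes>\<^bsub>?A\<^esub> ?F z" by simp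
      also have "\<dots> = aff v u \<epsilon> ((1 + int q * (l mod int q)) * gal_sgn \<epsilon>)"
        unfolding hF z v k(2) fst_conv snd_conv by simp
      also have "\<dots> = \<alpha>"
        unfolding vu(5) by (rule aff_cong[OF i_cong])
      finally show ?thesis .
    qed
    show "\<alpha> \<in> ?E ` carrier ?S"
      using imageI[OF mem_S, of ?E] unfolding E_eq .
  qed
  moreover have "?E ` carrier ?S \<subseteq> carrier ?A" using E by (rule hom_carrier)
  moreover have "inj_on ?E (carrier ?S)" using inj by (simp add: semidirect_product_def)
  ultimately have "?E \<in> iso ?S ?A" using E unfolding iso_def bij_betw_def by blast
  then have "?S \<cong> ?A" by (rule is_isoI)
  then have "?A \<cong> ?S" by (rule group.iso_sym[OF group_semidirect_product[OF V Y \<psi>]])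
  then show ?thesis using \<phi> \<psi> unfolding N_def by blast
qed

end

theorem mainTheorem12:
  fixes p q :: nat and D m n :: int
    and K :: "('k, 'r) ring_scheme" and s \<sigma> :: 'k
  assumes "prime p" and "prime q" and "p \<noteq> q" and "p * q \<noteq> 6" and "q dvd p + 1"
    and "\<not> QuadRes (int p) D"
    and "field K" and "order K = p^2"
    and "s \<in> carrier K" and "s [^]\<^bsub>K\<^esub> (2::nat) = [D] \<cdot>\<^bsub>K\<^esub> \<one>\<^bsub>K\<^esub>"
    and "\<sigma> \<in> carrier (mult_of K)" and "generate (mult_of K) {\<sigma>} = carrier (mult_of K)"
    and "[m] \<cdot>\<^bsub>K\<^esub> \<one>\<^bsub>K\<^esub> \<oplus>\<^bsub>K\<^esub> ([n] \<cdot>\<^bsub>K\<^esub> \<one>\<^bsub>K\<^esub>) \<otimes>\<^bsub>K\<^esub> s = \<sigma> [^]\<^bsub>K\<^esub> ((p^2 - 1) div q)"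
    and "\<not> [n = 0] (mod int p)"
  shows "\<exists>\<phi> \<psi>.
    \<phi> \<in> hom (integer_mod_group 2)
          (AutoGroup (integer_mod_group (p^2 - 1) \<times>\<times> integer_mod_group q)) \<and>
    \<psi> \<in> hom (semidirect_product (integer_mod_group (p^2 - 1) \<times>\<times> integer_mod_group q)
                (integer_mod_group 2) \<phi>)
          (AutoGroup (integer_mod_group p \<times>\<times> integer_mod_group p)) \<and>
    AutoGroup (G_group p q D m n) \<cong>
      semidirect_product (integer_mod_group p \<times>\<times> integer_mod_group p)
        (semidirect_product (integer_mod_group (p^2 - 1) \<times>\<times> integer_mod_group q)
          (integer_mod_group 2) \<phi>) \<psi>"
proof -
  interpret K: field K by fact
  interpret quadratic_extension K p D s
    using assms by unfold_locales (simp_all add: K.of_int_eq_add_pow numeral_2_eq_2)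
  define w where "w = \<sigma> [^]\<^bsub>K\<^esub> ((p\<^sup>2 - 1) div q)"
  interpret M: group "mult_of K" by (rule K.field_mult_group)
  have "q dvd (p + 1) * (p - 1)" using \<open>q dvd p + 1\<close> by (rule dvd_mult2)
  also have "(p + 1) * (p - 1) = p\<^sup>2 - 1"
    by (simp add: monoid_mult_class.power2_eq_square algebra_simps)
  finally have "(p\<^sup>2 - 1) div q * q = p\<^sup>2 - 1" by simp
  moreover have "\<sigma> [^]\<^bsub>mult_of K\<^esub> (p\<^sup>2 - 1) = \<one>\<^bsub>mult_of K\<^esub>"
    using M.pow_order_eq_1[OF \<open>\<sigma> \<in> carrier (mult_of K)\<close>] K.order_mult_of[OF finite_K] order_K by simp
  ultimately have w: "w [^]\<^bsub>K\<^esub> q = \<one>\<^bsub>K\<^esub>"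
    using \<open>\<sigma> \<in> carrier (mult_of K)\<close> by (simp add: w_def K.nat_pow_pow nat_pow_mult_of)
  interpret primitive_root K p D s q m n w \<sigma>
    using assms w
    by unfold_locales (simp_all add: el_def w_def K.of_int_eq_add_pow cong_0_iff)
  have "AutoGroup (G_group p q D m n) \<cong> AutoGroup H"
    using G_group_iso_H group_H
    by (intro AutoGroup_iso) (simp_all add: G_group_def group_presented_group)
  then show ?thesis using AutoGroup_H_iso iso_trans by blast
qed

end
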